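(* Assume that $\mathcal{G}$ is definably amenable and NIP, and let $\mathcal{H}$ be a type-definable subgroup of $\mathcal{G}$ of bounded index. Then $\mathcal{H}$ is also definably amenable.
   Context: Setting: $T$ is a first-order theory in a language $\mathcal{L}$ expanding a group, $\mathcal{G}$ is a sufficiently saturated (monster) model of $T$ ("$\mathcal{G}$ is NIP" means $T$ is NIP), and "small"/"bounded" mean small relative to the saturation of $\mathcal{G}$. $x$ is a singleton variable of the sort on which the group is defined. "Type-definable" means defined by a partial type over a small set. $\mathcal{L}_x(\mathcal{G})$ is the Boolean algebra of formulas in $x$ with parameters from $\mathcal{G}$ (up to equivalence); $\mathfrak{M}_x(\mathcal{G})$ is the set of finitely additive probability measures on $\mathcal{L}_x(\mathcal{G})$ (global Keisler measures), each identified with the corresponding regular Borel probability measure on the type space $S_x(\mathcal{G})$. A type-definable subgroup $\mathcal{H}$ of $\mathcal{G}$ with defining partial type $H(x)$ (in particular $\mathcal{G}$ itself) is definably amenable if there is $\mu\in\mathfrak{M}_x(\mathcal{G})$ with $\mu(H(x))=1$ (the measure of the closed set of types implying $H$) and $\mu(\varphi(x))=\mu(\varphi(x\cdot a))$ for all $\varphi(x)\in\mathcal{L}_x(\mathcal{G})$ and $a\in\mathcal{H}$. *)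

theory Defs
  imports "HOL-Probability.Probability_Measure" "HOL-Algebra.Coset"
begin

unbundle cardinal_syntax

text \<open>
  Every element of \<open>'s\<close> is a sort. The symbols are the members of \<open>funs\<close> and \<open>rels\<close>; the
  remaining fields give the sorts of arguments and results. A variable is a sort with an index.
\<close>

record ('f, 'r, 's) language =
  funs :: "'f set"
  fargs :: "'f \<Rightarrow> 's list"
  fres :: "'f \<Rightarrow> 's"
  rels :: "'r set"
  rargs :: "'r \<Rightarrow> 's list"

type_synonym 's var = "'s \<times> nat"

text \<open>
  Parameters are constants inside terms, so that formulas over a set \<open>A\<close> of parameters are exactly
  the formulas of the language with a new constant for each element of \<open>A\<close>.
\<close>

datatype ('f, 's, params_trm: 'c) trm =
  Var "'s var" | Par 'c | App 'f "('f, 's, 'c) trm list"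

datatype ('f, 'r, 's, params: 'c) fm =
    Eq "('f, 's, 'c) trm" "('f, 's, 'c) trm"
  | Rel 'r "('f, 's, 'c) trm list"
  | Neg "('f, 'r, 's, 'c) fm"
  | Conj "('f, 'r, 's, 'c) fm" "('f, 'r, 's, 'c) fm"
  | Ex "'s var" "('f, 'r, 's, 'c) fm"

abbreviation Disj :: "('f, 'r, 's, 'c) fm \<Rightarrow> ('f, 'r, 's, 'c) fm \<Rightarrow> ('f, 'r, 's, 'c) fm" where
  "Disj \<phi> \<psi> \<equiv> Neg (Conj (Neg \<phi>) (Neg \<psi>))"

text \<open>
  The universes of different sorts need not be disjoint, so a parameter is a pair of a sort and an
  element of that sort.
\<close>

inductive has_sort :: "('f, 'r, 's) language \<Rightarrow> ('f, 's, 's \<times> 'a) trm \<Rightarrow> 's \<Rightarrow> bool"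
  for L where
    "has_sort L (Var (s, n)) s"
  | "has_sort L (Par (s, a)) s"
  | "f \<in> funs L \<Longrightarrow> list_all2 (has_sort L) ts (fargs L f) \<Longrightarrow> has_sort L (App f ts) (fres L f)"

primrec wf_fm :: "('f, 'r, 's) language \<Rightarrow> ('f, 'r, 's, 's \<times> 'a) fm \<Rightarrow> bool" where
  "wf_fm L (Eq t u) \<longleftrightarrow> (\<exists>s. has_sort L t s \<and> has_sort L u s)"
| "wf_fm L (Rel r ts) \<longleftrightarrow> r \<in> rels L \<and> list_all2 (has_sort L) ts (rargs L r)"
| "wf_fm L (Neg \<phi>) \<longleftrightarrow> wf_fm L \<phi>"
| "wf_fm L (Conj \<phi> \<psi>) \<longleftrightarrow> wf_fm L \<phi> \<and> wf_fm L \<psi>"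
| "wf_fm L (Ex v \<phi>) \<longleftrightarrow> wf_fm L \<phi>"

primrec fv_trm :: "('f, 's, 'c) trm \<Rightarrow> 's var set" where
  "fv_trm (Var v) = {v}"
| "fv_trm (Par c) = {}"
| "fv_trm (App f ts) = \<Union> (set (map fv_trm ts))"

primrec fv :: "('f, 'r, 's, 'c) fm \<Rightarrow> 's var set" where
  "fv (Eq t u) = fv_trm t \<union> fv_trm u"
| "fv (Rel r ts) = \<Union> (set (map fv_trm ts))"
| "fv (Neg \<phi>) = fv \<phi>"
| "fv (Conj \<phi> \<psi>) = fv \<phi> \<union> fv \<psi>"
| "fv (Ex v \<phi>) = fv \<phi> - {v}"

primrec subst_trm :: "'s var \<Rightarrow> ('f, 's, 'c) trm \<Rightarrow> ('f, 's, 'c) trm \<Rightarrow> ('f, 's, 'c) trm" where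
  "subst_trm v t (Var w) = (if w = v then t else Var w)"
| "subst_trm v t (Par c) = Par c"
| "subst_trm v t (App f ts) = App f (map (subst_trm v t) ts)"

text \<open>
  Bound variables are not renamed. This is correct substitution of \<open>t\<close> for \<open>v\<close> as long as \<open>t\<close>
  contains no variable other than \<open>v\<close>, which is the only case used below.
\<close>

primrec subst :: "'s var \<Rightarrow> ('f, 's, 'c) trm \<Rightarrow> ('f, 'r, 's, 'c) fm \<Rightarrow> ('f, 'r, 's, 'c) fm" where
  "subst v t (Eq u u') = Eq (subst_trm v t u) (subst_trm v t u')"
| "subst v t (Rel r ts) = Rel r (map (subst_trm v t) ts)"
| "subst v t (Neg \<phi>) = Neg (subst v t \<phi>)"
| "subst v t (Conj \<phi> \<psi>) = Conj (subst v t \<phi>) (subst v t \<psi>)"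
| "subst v t (Ex w \<phi>) = (if w = v then Ex w \<phi> else Ex w (subst v t \<phi>))"

record ('f, 'r, 's, 'a) model =
  univ :: "'s \<Rightarrow> 'a set"
  fint :: "'f \<Rightarrow> 'a list \<Rightarrow> 'a"
  rint :: "'r \<Rightarrow> 'a list \<Rightarrow> bool"

definition is_structure :: "('f, 'r, 's) language \<Rightarrow> ('f, 'r, 's, 'a) model \<Rightarrow> bool" where
  "is_structure L M \<longleftrightarrow>
     (\<forall>s. univ M s \<noteq> {}) \<and>
     (\<forall>f\<in>funs L. \<forall>as. list_all2 (\<lambda>a s. a \<in> univ M s) as (fargs L f) \<longrightarrow>
        fint M f as \<in> univ M (fres L f))"

definition elts :: "('f, 'r, 's, 'a) model \<Rightarrow> ('s \<times> 'a) set" where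
  "elts M = {(s, a). a \<in> univ M s}"

definition envs :: "('f, 'r, 's, 'a) model \<Rightarrow> ('s var \<Rightarrow> 'a) set" where
  "envs M = {e. \<forall>v. e v \<in> univ M (fst v)}"

primrec eval_trm :: "('f, 'r, 's, 'a) model \<Rightarrow> ('s var \<Rightarrow> 'a) \<Rightarrow> ('f, 's, 's \<times> 'a) trm \<Rightarrow> 'a" where
  "eval_trm M e (Var v) = e v"
| "eval_trm M e (Par c) = snd c"
| "eval_trm M e (App f ts) = fint M f (map (eval_trm M e) ts)"

primrec sat :: "('f, 'r, 's, 'a) model \<Rightarrow> ('s var \<Rightarrow> 'a) \<Rightarrow> ('f, 'r, 's, 's \<times> 'a) fm \<Rightarrow> bool" where
  "sat M e (Eq t u) \<longleftrightarrow> eval_trm M e t = eval_trm M e u"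
| "sat M e (Rel r ts) \<longleftrightarrow> rint M r (map (eval_trm M e) ts)"
| "sat M e (Neg \<phi>) \<longleftrightarrow> \<not> sat M e \<phi>"
| "sat M e (Conj \<phi> \<psi>) \<longleftrightarrow> sat M e \<phi> \<and> sat M e \<psi>"
| "sat M e (Ex v \<phi>) \<longleftrightarrow> (\<exists>a\<in>univ M (fst v). sat M (e(v := a)) \<phi>)"

definition formulas ::
  "('f, 'r, 's) language \<Rightarrow> ('s \<times> 'a) set \<Rightarrow> 's var set \<Rightarrow> ('f, 'r, 's, 's \<times> 'a) fm set" where
  "formulas L A V = {\<phi>. wf_fm L \<phi> \<and> params \<phi> \<subseteq> A \<and> fv \<phi> \<subseteq> V}"

definition models_sentence ::
  "('f, 'r, 's, 'a) model \<Rightarrow> ('f, 'r, 's, 's \<times> 'a) fm \<Rightarrow> bool" where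
  "models_sentence M \<phi> \<longleftrightarrow> (\<forall>e\<in>envs M. sat M e \<phi>)"

text \<open>
  From here on, the singleton variable \<open>x\<close> of sort \<open>s\<close> is the variable \<open>(s, 0)\<close>.
\<close>

definition forms_x ::
  "('f, 'r, 's) language \<Rightarrow> ('s \<times> 'a) set \<Rightarrow> 's \<Rightarrow> ('f, 'r, 's, 's \<times> 'a) fm set" where
  "forms_x L A s = formulas L A {(s, 0)}"

definition holds_at ::
  "('f, 'r, 's, 'a) model \<Rightarrow> 's \<Rightarrow> ('f, 'r, 's, 's \<times> 'a) fm \<Rightarrow> 'a \<Rightarrow> bool" where
  "holds_at M s \<phi> a \<longleftrightarrow> (\<forall>e\<in>envs M. sat M (e((s, 0) := a)) \<phi>)"

definition realizations ::
  "('f, 'r, 's, 'a) model \<Rightarrow> 's \<Rightarrow> ('f, 'r, 's, 's \<times> 'a) fm set \<Rightarrow> 'a set" where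
  "realizations M s \<Phi> = {a \<in> univ M s. \<forall>\<phi>\<in>\<Phi>. holds_at M s \<phi> a}"

definition finitely_satisfiable ::
  "('f, 'r, 's, 'a) model \<Rightarrow> 's \<Rightarrow> ('f, 'r, 's, 's \<times> 'a) fm set \<Rightarrow> bool" where
  "finitely_satisfiable M s \<Phi> \<longleftrightarrow> (\<forall>\<Psi>\<subseteq>\<Phi>. finite \<Psi> \<longrightarrow> realizations M s \<Psi> \<noteq> {})"

definition strong_limit :: "'k rel \<Rightarrow> bool" where
  "strong_limit \<kappa> \<longleftrightarrow> Card_order \<kappa> \<and> (\<forall>X\<subseteq>Field \<kappa>. |X| <o \<kappa> \<longrightarrow> |Pow X| <o \<kappa>)"

definition saturated ::
  "('f, 'r, 's) language \<Rightarrow> 'k rel \<Rightarrow> ('f, 'r, 's, 'a) model \<Rightarrow> bool" where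
  "saturated L \<kappa> M \<longleftrightarrow>
     (\<forall>A s \<Phi>. A \<subseteq> elts M \<and> |A| <o \<kappa> \<and> \<Phi> \<subseteq> forms_x L A s \<and> finitely_satisfiable M s \<Phi> \<longrightarrow>
        realizations M s \<Phi> \<noteq> {})"

definition partial_elementary ::
  "('f, 'r, 's) language \<Rightarrow> ('f, 'r, 's, 'a) model \<Rightarrow> ('s \<times> 'a) set \<Rightarrow> ('s \<times> 'a \<Rightarrow> 's \<times> 'a) \<Rightarrow> bool"
  where
  "partial_elementary L M A h \<longleftrightarrow>
     A \<subseteq> elts M \<and> h ` A \<subseteq> elts M \<and> (\<forall>c\<in>A. fst (h c) = fst c) \<and>
     (\<forall>\<phi>\<in>formulas L A {}. models_sentence M \<phi> \<longleftrightarrow> models_sentence M (map_fm id id id h \<phi>))"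

definition automorphism ::
  "('f, 'r, 's) language \<Rightarrow> ('f, 'r, 's, 'a) model \<Rightarrow> ('s \<Rightarrow> 'a \<Rightarrow> 'a) \<Rightarrow> bool" where
  "automorphism L M \<sigma> \<longleftrightarrow>
     (\<forall>s. bij_betw (\<sigma> s) (univ M s) (univ M s)) \<and>
     (\<forall>f\<in>funs L. \<forall>as. list_all2 (\<lambda>a s. a \<in> univ M s) as (fargs L f) \<longrightarrow>
        fint M f (map2 \<sigma> (fargs L f) as) = \<sigma> (fres L f) (fint M f as)) \<and>
     (\<forall>r\<in>rels L. \<forall>as. list_all2 (\<lambda>a s. a \<in> univ M s) as (rargs L r) \<longrightarrow>
        (rint M r (map2 \<sigma> (rargs L r) as) \<longleftrightarrow> rint M r as))"

definition strongly_homogeneous ::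
  "('f, 'r, 's) language \<Rightarrow> 'k rel \<Rightarrow> ('f, 'r, 's, 'a) model \<Rightarrow> bool" where
  "strongly_homogeneous L \<kappa> M \<longleftrightarrow>
     (\<forall>A h. |A| <o \<kappa> \<and> partial_elementary L M A h \<longrightarrow>
        (\<exists>\<sigma>. automorphism L M \<sigma> \<and> (\<forall>(s, a)\<in>A. h (s, a) = (s, \<sigma> s a))))"

text \<open>
  ``Small'' means of cardinality less than \<open>\<kappa>\<close>. The set of parameter-free formulas has cardinality
  \<open>|L| + \<aleph>\<^sub>0\<close>, so \<open>\<kappa>\<close> is uncountable and bigger than the language.
\<close>

definition monster_model ::
  "('f, 'r, 's) language \<Rightarrow> ('f, 'r, 's, 's \<times> 'a) fm set \<Rightarrow> 'k rel \<Rightarrow> ('f, 'r, 's, 'a) model \<Rightarrow> bool"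
  where
  "monster_model L T \<kappa> M \<longleftrightarrow>
     is_structure L M \<and>
     T \<subseteq> formulas L {} {} \<and> (\<forall>\<phi>\<in>T. models_sentence M \<phi>) \<and>
     strong_limit \<kappa> \<and> |formulas L ({} :: ('s \<times> 'a) set) UNIV| <o \<kappa> \<and>
     saturated L \<kappa> M \<and> strongly_homogeneous L \<kappa> M"

text \<open>
  The independence property is tested in the monster model, where it agrees with the property for
  the theory. The free variables of \<open>\<phi>\<close> are partitioned into the object variables \<open>V\<close> and the remaining
  (parameter) variables. A tuple of either kind is given by an environment restricted to the
  corresponding variables, so \<open>a i\<close> and \<open>b I\<close> below are tuples \<open>a\<^sub>i\<close>, \<open>b\<^sub>I\<close> with
  \<open>\<phi>(a\<^sub>i, b\<^sub>I)\<close> iff \<open>i \<in> I\<close>.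
\<close>

definition has_IP ::
  "('f, 'r, 's, 'a) model \<Rightarrow> ('f, 'r, 's, 's \<times> 'a) fm \<Rightarrow> 's var set \<Rightarrow> bool" where
  "has_IP M \<phi> V \<longleftrightarrow>
     (\<exists>(a :: nat \<Rightarrow> 's var \<Rightarrow> 'a) (b :: nat set \<Rightarrow> 's var \<Rightarrow> 'a).
        (\<forall>i. a i \<in> envs M) \<and> (\<forall>I. b I \<in> envs M) \<and>
        (\<forall>i I. sat M (\<lambda>v. if v \<in> V then a i v else b I v) \<phi> \<longleftrightarrow> i \<in> I))"

definition NIP :: "('f, 'r, 's) language \<Rightarrow> ('f, 'r, 's, 'a) model \<Rightarrow> bool" where
  "NIP L M \<longleftrightarrow> (\<forall>\<phi>\<in>formulas L {} UNIV. \<forall>V. \<not> has_IP M \<phi> V)"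

definition type_space ::
  "('f, 'r, 's) language \<Rightarrow> ('f, 'r, 's, 'a) model \<Rightarrow> 's \<Rightarrow> ('f, 'r, 's, 's \<times> 'a) fm set set" where
  "type_space L M s =
     {p. p \<subseteq> forms_x L (elts M) s \<and> finitely_satisfiable M s p \<and>
         (\<forall>\<phi>\<in>forms_x L (elts M) s. \<phi> \<in> p \<or> Neg \<phi> \<in> p)}"

definition types_containing ::
  "('f, 'r, 's) language \<Rightarrow> ('f, 'r, 's, 'a) model \<Rightarrow> 's \<Rightarrow> ('f, 'r, 's, 's \<times> 'a) fm set \<Rightarrow>
     ('f, 'r, 's, 's \<times> 'a) fm set set" where
  "types_containing L M s \<Phi> = {p \<in> type_space L M s. \<Phi> \<subseteq> p}"

definition type_topology ::
  "('f, 'r, 's) language \<Rightarrow> ('f, 'r, 's, 'a) model \<Rightarrow> 's \<Rightarrow>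
     ('f, 'r, 's, 's \<times> 'a) fm set topology" where
  "type_topology L M s =
     topology_generated_by ((\<lambda>\<phi>. types_containing L M s {\<phi>}) ` forms_x L (elts M) s)"

definition regular_borel_probability :: "'b topology \<Rightarrow> 'b measure \<Rightarrow> bool" where
  "regular_borel_probability X N \<longleftrightarrow>
     prob_space N \<and> space N = topspace X \<and> sets N = sigma_sets (topspace X) {U. openin X U} \<and>
     (\<forall>B\<in>sets N. emeasure N B = (SUP C\<in>{C. closedin X C \<and> C \<subseteq> B}. emeasure N C) \<and>
                  emeasure N B = (INF U\<in>{U. openin X U \<and> B \<subseteq> U}. emeasure N U))"

text \<open>
  A measure on the Boolean algebra of formulas up to equivalence is a function on formulas over \<open>M\<close>
  that respects equivalence in \<open>M\<close>.
\<close>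

definition keisler_measure ::
  "('f, 'r, 's) language \<Rightarrow> ('f, 'r, 's, 'a) model \<Rightarrow> 's \<Rightarrow>
     (('f, 'r, 's, 's \<times> 'a) fm \<Rightarrow> real) \<Rightarrow> bool" where
  "keisler_measure L M s \<mu> \<longleftrightarrow>
     (\<forall>\<phi>\<in>forms_x L (elts M) s. 0 \<le> \<mu> \<phi>) \<and>
     \<mu> (Eq (Var (s, 0)) (Var (s, 0))) = 1 \<and>
     (\<forall>\<phi>\<in>forms_x L (elts M) s. \<forall>\<psi>\<in>forms_x L (elts M) s.
        realizations M s {\<phi>} = realizations M s {\<psi>} \<longrightarrow> \<mu> \<phi> = \<mu> \<psi>) \<and>
     (\<forall>\<phi>\<in>forms_x L (elts M) s. \<forall>\<psi>\<in>forms_x L (elts M) s.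
        realizations M s {\<phi>, \<psi>} = {} \<longrightarrow> \<mu> (Disj \<phi> \<psi>) = \<mu> \<phi> + \<mu> \<psi>)"

text \<open>\<open>N\<close> is the (unique) regular Borel probability measure identified with \<open>\<mu>\<close>.\<close>

definition borel_extension ::
  "('f, 'r, 's) language \<Rightarrow> ('f, 'r, 's, 'a) model \<Rightarrow> 's \<Rightarrow>
     (('f, 'r, 's, 's \<times> 'a) fm \<Rightarrow> real) \<Rightarrow> ('f, 'r, 's, 's \<times> 'a) fm set measure \<Rightarrow> bool" where
  "borel_extension L M s \<mu> N \<longleftrightarrow>
     regular_borel_probability (type_topology L M s) N \<and>
     (\<forall>\<phi>\<in>forms_x L (elts M) s. measure N (types_containing L M s {\<phi>}) = \<mu> \<phi>)"

text \<open>
  \<open>g\<close> is the sort of the group and \<open>m\<close> the symbol for its multiplication. The unit and the inverse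
  are determined by the multiplication, so no symbols for them are required.
\<close>

definition group_of :: "('f, 'r, 's, 'a) model \<Rightarrow> 's \<Rightarrow> 'f \<Rightarrow> 'a monoid" where
  "group_of M g m =
     \<lparr>carrier = univ M g, mult = (\<lambda>a b. fint M m [a, b]),
      one = (THE e. e \<in> univ M g \<and> (\<forall>a\<in>univ M g. fint M m [e, a] = a \<and> fint M m [a, e] = a))\<rparr>"

definition expands_group ::
  "('f, 'r, 's) language \<Rightarrow> ('f, 'r, 's, 'a) model \<Rightarrow> 's \<Rightarrow> 'f \<Rightarrow> bool" where
  "expands_group L M g m \<longleftrightarrow>
     m \<in> funs L \<and> fargs L m = [g, g] \<and> fres L m = g \<and> group (group_of M g m)"

definition type_defines_subgroup ::
  "('f, 'r, 's) language \<Rightarrow> 'k rel \<Rightarrow> ('f, 'r, 's, 'a) model \<Rightarrow> 's \<Rightarrow> 'f \<Rightarrow>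
     ('f, 'r, 's, 's \<times> 'a) fm set \<Rightarrow> bool" where
  "type_defines_subgroup L \<kappa> M g m \<Phi> \<longleftrightarrow>
     (\<exists>A. A \<subseteq> elts M \<and> |A| <o \<kappa> \<and> \<Phi> \<subseteq> forms_x L A g) \<and>
     subgroup (realizations M g \<Phi>) (group_of M g m)"

definition bounded_index ::
  "'k rel \<Rightarrow> ('f, 'r, 's, 'a) model \<Rightarrow> 's \<Rightarrow> 'f \<Rightarrow> 'a set \<Rightarrow> bool" where
  "bounded_index \<kappa> M g m H \<longleftrightarrow> |rcosets\<^bsub>group_of M g m\<^esub> H| <o \<kappa>"

definition translate ::
  "'s \<Rightarrow> 'f \<Rightarrow> 'a \<Rightarrow> ('f, 'r, 's, 's \<times> 'a) fm \<Rightarrow> ('f, 'r, 's, 's \<times> 'a) fm" where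
  "translate g m a \<phi> = subst (g, 0) (App m [Var (g, 0), Par (g, a)]) \<phi>"

definition definably_amenable ::
  "('f, 'r, 's) language \<Rightarrow> ('f, 'r, 's, 'a) model \<Rightarrow> 's \<Rightarrow> 'f \<Rightarrow>
     ('f, 'r, 's, 's \<times> 'a) fm set \<Rightarrow> bool" where
  "definably_amenable L M g m \<Phi> \<longleftrightarrow>
     (\<exists>\<mu>. keisler_measure L M g \<mu> \<and>
        (\<exists>N. borel_extension L M g \<mu> N \<and> measure N (types_containing L M g \<Phi>) = 1) \<and>
        (\<forall>\<phi>\<in>forms_x L (elts M) g. \<forall>a\<in>realizations M g \<Phi>. \<mu> \<phi> = \<mu> (translate g m a \<phi>)))"

text \<open>The partial type \<open>{x = x}\<close> defines the whole group.\<close>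

definition whole_group :: "'s \<Rightarrow> ('f, 'r, 's, 's \<times> 'a) fm set" where
  "whole_group g = {Eq (Var (g, 0)) (Var (g, 0))}"

end

theory Submission
  imports Defs
begin

text \<open>
  Why the theorem holds. Let \<open>H\<close> be the type-definable subgroup and \<open>\<mu>\<close> a right-invariant Keisler measure
  of the whole group. If \<open>H\<close> had finite index, one would restrict \<open>\<mu>\<close> to \<open>H\<close> and normalize. In
  general \<open>H\<close> may be null, and the measure is obtained as a limit of conditional measures.

  Consider the definable sets \<open>D\<close> given by finite parts of the partial type of \<open>H\<close>. Bounded index and
  saturation provide one left coset \<open>c H\<close> all of whose neighbourhoods \<open>c D\<close> have positive measure
  (\<open>coset_of_positive_content\<close>). Fix \<open>D\<close> and let \<open>W\<close> be the intersection of the translates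
  \<open>c D h\<close> for \<open>h\<close> in \<open>H\<close>. Right translation by \<open>H\<close> permutes these translates, so \<open>W\<close> is exactly
  \<open>H\<close>-invariant. It is not null: by saturation there is another finite part \<open>E\<close> with \<open>E H \<subseteq> D\<close>
  (\<open>finite_part_absorbs_subgroup\<close>), so \<open>W\<close> contains \<open>c E\<close>. Since both \<open>\<mu>\<close> and \<open>W\<close> are invariant under \<open>H\<close>,
  so is \<open>\<mu>\<close> conditioned on \<open>W\<close> (\<open>condition_on_translates\<close>). It lives on \<open>c D\<close>, and moving it by the left
  translation by \<open>c\<close>, which commutes with right translations, places it on \<open>D\<close>. Compactness of the
  space of finitely additive measures yields a limit which is invariant under \<open>H\<close> and gives measure
  one to every \<open>D\<close> (\<open>invariant_content_on_subgroup\<close>).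

  All this takes place with finitely additive measures on definable sets. What remains is
  the passage to the regular Borel measure on the type space: a finitely additive probability
  on a clopen base of a compact space extends to a regular Borel measure, and an intersection of
  any number of clopen sets of measure one has measure one (\<open>regular_borel_extension\<close>,
  \<open>measure_Inter_eq_one\<close>). The latter gives measure one to the closed set of types containing the partial
  type of \<open>H\<close>.
\<close>

section \<open>Regular Borel extensions of finitely additive measures\<close>

definition finitely_additive_prob :: "'b set \<Rightarrow> 'b set set \<Rightarrow> ('b set \<Rightarrow> real) \<Rightarrow> bool" where
  "finitely_additive_prob \<Omega> \<B> \<mu> \<longleftrightarrow>
     (\<forall>X\<in>\<B>. 0 \<le> \<mu> X) \<and> \<mu> \<Omega> = 1 \<and>
     (\<forall>X\<in>\<B>. \<forall>Y\<in>\<B>. X \<inter> Y = {} \<longrightarrow> \<mu> (X \<union> Y) = \<mu> X + \<mu> Y)"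

locale content = algebra \<Omega> \<B> for \<Omega> :: "'b set" and \<B> +
  fixes \<mu> :: "'b set \<Rightarrow> real"
  assumes prob: "finitely_additive_prob \<Omega> \<B> \<mu>"
begin

lemma nonneg: "X \<in> \<B> \<Longrightarrow> 0 \<le> \<mu> X"
  and total: "\<mu> \<Omega> = 1"
  and add: "X \<in> \<B> \<Longrightarrow> Y \<in> \<B> \<Longrightarrow> X \<inter> Y = {} \<Longrightarrow> \<mu> (X \<union> Y) = \<mu> X + \<mu> Y"
  using prob unfolding finitely_additive_prob_def by blast+

lemma empty: "\<mu> {} = 0"
  using add[of "{}" "{}"] by simp

lemma mono:
  assumes "X \<in> \<B>" "Y \<in> \<B>" "X \<subseteq> Y"
  shows "\<mu> X \<le> \<mu> Y"
  using add[of X "Y - X"] nonneg[of "Y - X"] assms by (simp add: Un_absorb1 Diff)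

lemma diff: "X \<in> \<B> \<Longrightarrow> Y \<in> \<B> \<Longrightarrow> \<mu> (Y - X) + \<mu> (Y \<inter> X) = \<mu> Y"
proof -
  assume "X \<in> \<B>" "Y \<in> \<B>"
  then have "\<mu> ((Y - X) \<union> (Y \<inter> X)) = \<mu> (Y - X) + \<mu> (Y \<inter> X)" by (intro add) auto
  then show ?thesis by (simp add: Un_Diff_Int)
qed

lemma compl: "X \<in> \<B> \<Longrightarrow> \<mu> (\<Omega> - X) = 1 - \<mu> X"
  using add[of X "\<Omega> - X"] sets_into_space[of X] total by (simp add: Un_absorb1 compl_sets)

lemma le_one: "X \<in> \<B> \<Longrightarrow> \<mu> X \<le> 1"
  using mono[of X \<Omega>] sets_into_space total by auto

lemma subadd:
  assumes "X \<in> \<B>" "Y \<in> \<B>" shows "\<mu> (X \<union> Y) \<le> \<mu> X + \<mu> Y"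
proof -
  have "\<mu> (X \<union> (Y - X)) = \<mu> X + \<mu> (Y - X)" using assms by (intro add) auto
  moreover have "\<mu> (Y - X) \<le> \<mu> Y" using assms by (intro mono) auto
  ultimately show ?thesis by simp
qed

lemma finite_subadd:
  "finite I \<Longrightarrow> (\<And>i. i \<in> I \<Longrightarrow> X i \<in> \<B>) \<Longrightarrow> \<mu> (\<Union>i\<in>I. X i) \<le> (\<Sum>i\<in>I. \<mu> (X i))"
proof (induction I rule: finite_induct)
  case (insert i I)
  have "\<mu> (X i \<union> (\<Union>i\<in>I. X i)) \<le> \<mu> (X i) + \<mu> (\<Union>i\<in>I. X i)"
    using insert by (intro subadd finite_UN) auto
  with insert show ?case by fastforce
qed (simp add: empty)

text \<open>
  This strong form of the finite intersection property for sets of content one provides the finite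
  satisfiability that saturation asks for.
\<close>

lemma finite_Inter_eq_one:
  "finite \<F> \<Longrightarrow> \<F> \<subseteq> \<B> \<Longrightarrow> (\<And>X. X \<in> \<F> \<Longrightarrow> \<mu> X = 1) \<Longrightarrow> \<mu> (\<Omega> \<inter> \<Inter>\<F>) = 1 \<and> \<Omega> \<inter> \<Inter>\<F> \<in> \<B>"
proof (induction \<F> rule: finite_induct)
  case (insert X \<F>)
  let ?Y = "\<Omega> \<inter> \<Inter>\<F>"
  have Y: "\<mu> ?Y = 1" "?Y \<in> \<B>" and X: "X \<in> \<B>" "\<mu> X = 1" using insert by auto
  have "\<mu> (?Y - X) \<le> \<mu> (\<Omega> - X)" using X Y by (intro mono) auto
  then have "\<mu> (?Y - X) = 0" using compl[of X] X Y nonneg[of "?Y - X"] by auto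
  then have "\<mu> (?Y \<inter> X) = 1" using diff[of X ?Y] X Y by auto
  moreover have "\<Omega> \<inter> \<Inter>(insert X \<F>) = ?Y \<inter> X" by auto
  ultimately show ?case using X Y by auto
qed (simp add: total)

end

text \<open>
  The topology generated by an algebra \<open>\<B>\<close> has the members of \<open>\<B>\<close> as a base of clopen sets, and
  its compactness can be tested on covers by members of \<open>\<B>\<close>. The Borel sets
  may well exceed the sigma-algebra generated by \<open>\<B>\<close>, so extending \<open>\<mu>\<close> from the algebra \<open>\<B>\<close> by
  Caratheodory's theorem is not enough: the outer measure has to be built from open sets.
\<close>

locale compact_content = content \<Omega> \<B> \<mu> for \<Omega> :: "'b set" and \<B> \<mu> +
  assumes compact: "\<And>\<C>. \<C> \<subseteq> \<B> \<Longrightarrow> \<Union>\<C> = \<Omega> \<Longrightarrow> \<exists>\<F>\<subseteq>\<C>. finite \<F> \<and> \<Union>\<F> = \<Omega>"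
begin

abbreviation \<T> where "\<T> \<equiv> topology_generated_by \<B>"

lemma Union_base [simp]: "\<Union>\<B> = \<Omega>"
  using sets_into_space top by auto

lemma topspace: "topspace \<T> = \<Omega>"
  by simp

lemma open_subset: "openin \<T> U \<Longrightarrow> U \<subseteq> \<Omega>"
  using openin_subset[of \<T> U] by simp

lemma open_base: "B \<in> \<B> \<Longrightarrow> openin \<T> B"
  by (rule topology_generated_by_Basis)

lemma closed_base: "B \<in> \<B> \<Longrightarrow> closedin \<T> B"
  using sets_into_space by (auto simp: closedin_def open_base compl_sets)

lemma base:
  assumes "openin \<T> U" "x \<in> U"
  shows "\<exists>B\<in>\<B>. x \<in> B \<and> B \<subseteq> U"
proof -
  have "generate_topology_on \<B> U"
    using assms(1) by (simp add: openin_topology_generated_by_iff)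
  then show ?thesis using assms(2)
  proof induction
    case (Int a b)
    then obtain A B where "A \<in> \<B>" "B \<in> \<B>" "x \<in> A" "x \<in> B" "A \<subseteq> a" "B \<subseteq> b" by auto
    then show ?case by (intro bexI[of _ "A \<inter> B"]) auto
  next
    case (UN K)
    then obtain k where "k \<in> K" "x \<in> k" by auto
    with UN.IH[of k] obtain B where "B \<in> \<B>" "x \<in> B" "B \<subseteq> k" by auto
    with \<open>k \<in> K\<close> show ?case by auto
  qed auto
qed

lemma compact_space: "compact_space \<T>"
  unfolding compact_space
proof (intro allI impI)
  fix \<U> assume U: "(\<forall>U\<in>\<U>. openin \<T> U) \<and> \<Union>\<U> = topspace \<T>"
  define \<C> where "\<C> = {B \<in> \<B>. \<exists>U\<in>\<U>. B \<subseteq> U}"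
  have "\<Union>\<C> = \<Omega>"
  proof
    show "\<Union>\<C> \<subseteq> \<Omega>" using sets_into_space by (auto simp: \<C>_def)
    show "\<Omega> \<subseteq> \<Union>\<C>"
    proof
      fix x assume "x \<in> \<Omega>"
      then have "x \<in> \<Union>\<U>" using U by simp
      then obtain V where V: "V \<in> \<U>" "x \<in> V" by (rule UnionE)
      then obtain B where "B \<in> \<B>" "x \<in> B" "B \<subseteq> V" using base[of V x] U by auto
      then show "x \<in> \<Union>\<C>" using V unfolding \<C>_def by auto
    qed
  qed
  moreover have "\<C> \<subseteq> \<B>" by (auto simp: \<C>_def)
  ultimately obtain \<F> where F: "\<F> \<subseteq> \<C>" "finite \<F>" "\<Union>\<F> = \<Omega>" using compact[of \<C>] by auto
  have "\<forall>B\<in>\<F>. \<exists>U. U \<in> \<U> \<and> B \<subseteq> U" using F(1) by (auto simp: \<C>_def)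
  then obtain u where u: "\<forall>B\<in>\<F>. u B \<in> \<U> \<and> B \<subseteq> u B" by metis
  then have "\<Union>(u ` \<F>) = topspace \<T>" using F(3) U by fastforce
  then show "\<exists>\<F>. finite \<F> \<and> \<F> \<subseteq> \<U> \<and> \<Union>\<F> = topspace \<T>"
    using F(2) u by (intro exI[of _ "u ` \<F>"]) auto
qed

definition inner_content :: "'b set \<Rightarrow> ennreal" where
  "inner_content U = (SUP B\<in>{B \<in> \<B>. B \<subseteq> U}. ennreal (\<mu> B))"

definition outer :: "'b set \<Rightarrow> ennreal" where
  "outer A = (INF U\<in>{U. openin \<T> U \<and> A \<subseteq> U}. inner_content U)"

lemma inner_content_upper: "B \<in> \<B> \<Longrightarrow> B \<subseteq> U \<Longrightarrow> ennreal (\<mu> B) \<le> inner_content U"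
  unfolding inner_content_def by (rule SUP_upper) auto

lemma inner_content_base: "B \<in> \<B> \<Longrightarrow> inner_content B = ennreal (\<mu> B)"
  unfolding inner_content_def
  by (rule antisym, rule SUP_least) (auto intro!: SUP_upper ennreal_leI mono)

lemma inner_content_mono: "U \<subseteq> V \<Longrightarrow> inner_content U \<le> inner_content V"
  unfolding inner_content_def by (rule SUP_subset_mono) auto

text \<open>
  This is where compactness enters: a clopen subset of the union is covered by finitely many clopen
  sets, each inside some \<open>U i\<close>, and finite subadditivity of \<open>\<mu>\<close> applies.
\<close>

lemma inner_content_countably_subadditive:
  assumes U: "\<And>i::nat. openin \<T> (U i)"
  shows "inner_content (\<Union>i. U i) \<le> (\<Sum>i. inner_content (U i))"
  unfolding inner_content_def[of "\<Union>i. U i"]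
proof (rule SUP_least)
  fix B assume "B \<in> {B \<in> \<B>. B \<subseteq> (\<Union>i. U i)}"
  then have B: "B \<in> \<B>" "B \<subseteq> (\<Union>i. U i)" by auto
  have "compactin \<T> B"
    using closed_base[OF B(1)] compact_space by (simp add: closedin_compact_space)
  moreover have "B \<subseteq> \<Union>{C \<in> \<B>. \<exists>i. C \<subseteq> U i}"
  proof
    fix x assume "x \<in> B"
    then obtain i where "x \<in> U i" using B(2) by auto
    then obtain C where "C \<in> \<B>" "x \<in> C" "C \<subseteq> U i" using base[OF U] by metis
    then show "x \<in> \<Union>{C \<in> \<B>. \<exists>i. C \<subseteq> U i}" by auto
  qed
  ultimately have "\<exists>\<F>. finite \<F> \<and> \<F> \<subseteq> {C \<in> \<B>. \<exists>i. C \<subseteq> U i} \<and> B \<subseteq> \<Union>\<F>"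
    by (intro compactinD[of \<T>]) (auto intro: open_base)
  then obtain \<F> where F: "finite \<F>" "\<F> \<subseteq> {C \<in> \<B>. \<exists>i. C \<subseteq> U i}" "B \<subseteq> \<Union>\<F>"
    by blast
  from F(2) have "\<forall>C\<in>\<F>. \<exists>i. C \<subseteq> U i" by auto
  then obtain k where k: "\<forall>C\<in>\<F>. C \<subseteq> U (k C)" by (auto dest: bchoice)
  \<comment> \<open>Collecting the pieces by index makes the sum run over distinct indices, as in the series.\<close>
  define D where "D i = \<Union>{C \<in> \<F>. k C = i}" for i
  have D: "D i \<in> \<B>" for i
    using F by (auto simp: D_def intro!: finite_Union)
  have DU: "D i \<subseteq> U i" for i
    unfolding D_def using k by (intro Union_least) auto
  have "B \<subseteq> (\<Union>i\<in>k ` \<F>. D i)"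
  proof
    fix x assume "x \<in> B"
    then obtain C where "C \<in> \<F>" "x \<in> C" using F(3) by auto
    then show "x \<in> (\<Union>i\<in>k ` \<F>. D i)" unfolding D_def by (intro UN_I[of "k C"]) auto
  qed
  then have "\<mu> B \<le> \<mu> (\<Union>i\<in>k ` \<F>. D i)" using B D F by (intro mono finite_UN) auto
  also have "\<dots> \<le> (\<Sum>i\<in>k ` \<F>. \<mu> (D i))" using D F by (intro finite_subadd) auto
  finally have "ennreal (\<mu> B) \<le> (\<Sum>i\<in>k ` \<F>. ennreal (\<mu> (D i)))"
    using D nonneg by (simp add: ennreal_leI sum_ennreal)
  also have "\<dots> \<le> (\<Sum>i\<in>k ` \<F>. inner_content (U i))"
    using D DU by (intro sum_mono inner_content_upper)
  also have "\<dots> \<le> (\<Sum>i. inner_content (U i))"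
    using F by (intro sum_le_suminf) auto
  finally show "ennreal (\<mu> B) \<le> (\<Sum>i. inner_content (U i))" .
qed

lemma outer_lower: "openin \<T> U \<Longrightarrow> A \<subseteq> U \<Longrightarrow> outer A \<le> inner_content U"
  unfolding outer_def by (rule INF_lower) auto

lemma outer_mono: "A \<subseteq> A' \<Longrightarrow> outer A \<le> outer A'"
  unfolding outer_def by (rule INF_superset_mono) auto

lemma outer_open: "openin \<T> U \<Longrightarrow> outer U = inner_content U"
  unfolding outer_def
  by (rule antisym, rule INF_lower) (auto intro!: INF_greatest inner_content_mono)

lemma outer_base: "B \<in> \<B> \<Longrightarrow> outer B = ennreal (\<mu> B)"
  by (simp add: outer_open open_base inner_content_base)

lemma outer_le_one: "A \<subseteq> \<Omega> \<Longrightarrow> outer A \<le> 1"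
  using outer_mono[of A \<Omega>] outer_base[OF top] total by simp

lemma outer_approx:
  assumes "A \<subseteq> \<Omega>" "0 < e"
  shows "\<exists>U. openin \<T> U \<and> A \<subseteq> U \<and> inner_content U \<le> outer A + e"
proof -
  have "outer A < outer A + e"
    using outer_le_one[OF assms(1)] assms(2) by (metis add.right_neutral ennreal_add_left_cancel_less
        ennreal_one_neq_top infinity_ennreal_def top.not_eq_extremum top_unique)
  then show ?thesis
    unfolding outer_def INF_less_iff by (auto intro: less_imp_le)
qed

lemma outer_countably_subadditive:
  assumes A: "\<And>i::nat. A i \<subseteq> \<Omega>"
  shows "outer (\<Union>i. A i) \<le> (\<Sum>i. outer (A i))"
proof (rule ennreal_le_epsilon)
  fix e :: real assume e: "0 < e"
  let ?e = "\<lambda>i::nat. ennreal (e * (1/2) ^ Suc i)"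
  have "\<exists>U. openin \<T> U \<and> A i \<subseteq> U \<and> inner_content U \<le> outer (A i) + ?e i" for i
    using A e by (intro outer_approx) auto
  then obtain U where U: "\<And>i. openin \<T> (U i)" "\<And>i. A i \<subseteq> U i"
    "\<And>i. inner_content (U i) \<le> outer (A i) + ?e i" by metis
  have "outer (\<Union>i. A i) \<le> inner_content (\<Union>i. U i)" using U by (intro outer_lower) auto
  also have "\<dots> \<le> (\<Sum>i. inner_content (U i))"
    using U by (intro inner_content_countably_subadditive)
  also have "\<dots> \<le> (\<Sum>i. outer (A i) + ?e i)" using U by (intro suminf_le) auto
  also have "\<dots> = (\<Sum>i. outer (A i)) + (\<Sum>i. ?e i)" by (rule suminf_add[symmetric]) auto
  also have "(\<Sum>i. ?e i) = ennreal e"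
    using e sums_mult[OF power_half_series, of e] by (intro suminf_ennreal_eq) auto
  finally show "outer (\<Union>i. A i) \<le> (\<Sum>i. outer (A i)) + ennreal e" .
qed

lemma outer_measure: "outer_measure_space (Pow \<Omega>) outer"
proof -
  have "positive (Pow \<Omega>) outer" using outer_base[OF empty_sets] empty by (simp add: positive_def)
  moreover have "increasing (Pow \<Omega>) outer" by (simp add: increasing_def outer_mono)
  moreover have "countably_subadditive (Pow \<Omega>) outer"
    unfolding countably_subadditive_def
  proof (intro allI impI)
    fix A :: "nat \<Rightarrow> 'b set" assume "range A \<subseteq> Pow \<Omega>"
    then have "A i \<subseteq> \<Omega>" for i by auto
    then show "outer (\<Union>i. A i) \<le> (\<Sum>i. outer (A i))" by (rule outer_countably_subadditive)
  qed
  ultimately show ?thesis by (simp add: outer_measure_space_def)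
qed

lemma outer_Un: "A \<subseteq> \<Omega> \<Longrightarrow> A' \<subseteq> \<Omega> \<Longrightarrow> outer (A \<union> A') \<le> outer A + outer A'"
proof -
  assume s: "A \<subseteq> \<Omega>" "A' \<subseteq> \<Omega>"
  have "outer {} = 0" using outer_base[OF empty_sets] empty by simp
  then have "(\<Sum>i. outer (binaryset A A' i)) = outer A + outer A'"
    by (rule suminf_binaryset_eq)
  moreover have "binaryset A A' i \<subseteq> \<Omega>" for i using s by (auto simp: binaryset_def)
  ultimately show ?thesis
    using outer_countably_subadditive[of "binaryset A A'"] by (simp add: UN_binaryset_eq)
qed

text \<open>
  It suffices to split an open \<open>V\<close> containing the test set. A clopen \<open>B \<subseteq> V \<inter> U\<close> leaves the open set
  \<open>V - B\<close>, which contains \<open>A - U\<close>; exhausting \<open>V \<inter> U\<close> by such \<open>B\<close> gives the inequality.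
\<close>

lemma open_in_lambda_system:
  assumes U: "openin \<T> U"
  shows "U \<in> lambda_system \<Omega> (Pow \<Omega>) outer"
proof -
  interpret P: algebra \<Omega> "Pow \<Omega>" by (rule algebra_Pow)
  have sub: "U \<subseteq> \<Omega>" using U by (rule open_subset)
  have "outer (A \<inter> U) + outer (A - U) = outer A" if A: "A \<subseteq> \<Omega>" for A
  proof (rule antisym)
    have "A = (A \<inter> U) \<union> (A - U)" by auto
    then show "outer A \<le> outer (A \<inter> U) + outer (A - U)"
      using outer_Un[of "A \<inter> U" "A - U"] A by (metis Diff_subset inf_le1 order_trans)
    show "outer (A \<inter> U) + outer (A - U) \<le> outer A"
      unfolding outer_def[of A]
    proof (rule INF_greatest)
      fix V assume "V \<in> {V. openin \<T> V \<and> A \<subseteq> V}"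
      then have V: "openin \<T> V" "A \<subseteq> V" by auto
      have "ennreal (\<mu> B) + outer (A - U) \<le> inner_content V" if B: "B \<in> \<B>" "B \<subseteq> V \<inter> U" for B
      proof -
        have "outer (A - U) \<le> inner_content (V - B)"
          using V B by (intro outer_lower openin_diff closed_base) auto
        then have "ennreal (\<mu> B) + outer (A - U) \<le> ennreal (\<mu> B) + inner_content (V - B)"
          by (rule add_left_mono)
        also have "\<dots> = (SUP C\<in>{C \<in> \<B>. C \<subseteq> V - B}. ennreal (\<mu> B) + ennreal (\<mu> C))"
          unfolding inner_content_def by (rule ennreal_SUP_add_right) (auto intro!: exI[of _ "{}"])
        also have "\<dots> \<le> inner_content V"
        proof (rule SUP_least)
          fix C assume C: "C \<in> {C \<in> \<B>. C \<subseteq> V - B}"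
          then have "ennreal (\<mu> B) + ennreal (\<mu> C) = ennreal (\<mu> (B \<union> C))"
            using B nonneg by (subst add) (auto simp: ennreal_plus)
          also have "\<dots> \<le> inner_content V" using B C by (intro inner_content_upper) auto
          finally show "ennreal (\<mu> B) + ennreal (\<mu> C) \<le> inner_content V" .
        qed
        finally show ?thesis .
      qed
      then have "(SUP B\<in>{B \<in> \<B>. B \<subseteq> V \<inter> U}. ennreal (\<mu> B) + outer (A - U)) \<le> inner_content V"
        by (intro SUP_least) auto
      moreover have "(SUP B\<in>{B \<in> \<B>. B \<subseteq> V \<inter> U}. ennreal (\<mu> B) + outer (A - U))
          = inner_content (V \<inter> U) + outer (A - U)"
        unfolding inner_content_def by (rule ennreal_SUP_add_left) (auto intro!: exI[of _ "{}"])
      moreover have "outer (A \<inter> U) \<le> inner_content (V \<inter> U)"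
        using U V by (intro outer_lower openin_Int) auto
      ultimately show "outer (A \<inter> U) + outer (A - U) \<le> inner_content V"
        by (metis add_right_mono order_trans)
    qed
  qed
  then show ?thesis using sub by (auto simp: P.lambda_system_eq)
qed

text \<open>
  Outer regularity holds by construction of the outer measure, and inner regularity by closed sets
  is outer regularity of the complement.
\<close>

theorem regular_borel_extension:
  obtains N where "regular_borel_probability \<T> N" "\<And>B. B \<in> \<B> \<Longrightarrow> measure N B = \<mu> B"
proof -
  define \<O> where "\<O> = {U. openin \<T> U}"
  define N where "N = measure_of \<Omega> \<O> outer"
  interpret P: sigma_algebra \<Omega> "Pow \<Omega>" by (rule sigma_algebra_Pow)
  let ?L = "lambda_system \<Omega> (Pow \<Omega>) outer"
  have L: "measure_space \<Omega> ?L outer" by (rule P.caratheodory_lemma[OF outer_measure])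
  then interpret L: sigma_algebra \<Omega> ?L by (simp add: measure_space_def)
  have O_Pow: "\<O> \<subseteq> Pow \<Omega>" using open_subset by (auto simp: \<O>_def)
  have sets_N: "sets N = sigma_sets \<Omega> \<O>" and space_N: "space N = \<Omega>"
    using O_Pow by (auto simp: N_def)
  have "\<O> \<subseteq> ?L" using open_in_lambda_system by (auto simp: \<O>_def)
  then have sub: "sets N \<subseteq> ?L" using L.sigma_sets_subset sets_N by auto
  have "countably_additive ?L outer" using L by (simp add: measure_space_def)
  then have "countably_additive (sets N) outer"
    using sub unfolding countably_additive_def by blast
  then have N: "emeasure N A = outer A" if "A \<in> sets N" for A
    using that O_Pow outer_base[OF empty_sets] empty
    by (intro emeasure_measure_of[of N \<Omega> \<O>]) (auto simp: N_def positive_def)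
  have O_sets: "U \<in> sets N" if "openin \<T> U" for U
    using that by (auto simp: sets_N \<O>_def)
  have B_sets: "B \<in> sets N" if "B \<in> \<B>" for B
    using that by (intro O_sets open_base)
  interpret N: prob_space N
    using N[OF B_sets[OF top]] outer_base[OF top] total by (intro prob_spaceI) (simp add: space_N)
  have C_sets: "C \<in> sets N" if "closedin \<T> C" for C
  proof -
    have "\<Omega> - (\<Omega> - C) \<in> sets N"
      using that O_sets[of "\<Omega> - C"] sets.compl_sets[of "\<Omega> - C" N]
      by (simp add: closedin_def space_N)
    moreover have "\<Omega> - (\<Omega> - C) = C" using that closedin_subset by fastforce
    ultimately show ?thesis by simp
  qed
  have outer_reg: "emeasure N A = (INF U\<in>{U. openin \<T> U \<and> A \<subseteq> U}. emeasure N U)"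
    if "A \<in> sets N" for A
  proof -
    have "emeasure N U = inner_content U" if "openin \<T> U" for U
      using N[OF O_sets[OF that]] outer_open[OF that] by simp
    then show ?thesis unfolding N[OF that] outer_def by (intro INF_cong) auto
  qed
  have inner_reg: "emeasure N A = (SUP C\<in>{C. closedin \<T> C \<and> C \<subseteq> A}. emeasure N C)"
    if A: "A \<in> sets N" for A
  proof (rule antisym)
    show "(SUP C\<in>{C. closedin \<T> C \<and> C \<subseteq> A}. emeasure N C) \<le> emeasure N A"
      using A by (intro SUP_least emeasure_mono) auto
    show "emeasure N A \<le> (SUP C\<in>{C. closedin \<T> C \<and> C \<subseteq> A}. emeasure N C)"
    proof (rule ennreal_le_epsilon)
      fix e :: real assume e: "0 < e"
      have Asub: "A \<subseteq> \<Omega>" using A sets.sets_into_space space_N by blast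
      have cA: "\<Omega> - A \<in> sets N" using A sets.compl_sets space_N by metis
      obtain U where U: "openin \<T> U" "\<Omega> - A \<subseteq> U" "inner_content U \<le> outer (\<Omega> - A) + ennreal e"
        using outer_approx[of "\<Omega> - A" "ennreal e"] e by auto
      have Us: "U \<in> sets N" "U \<subseteq> \<Omega>" using U O_sets open_subset by auto
      let ?C = "\<Omega> - U"
      have C: "closedin \<T> ?C" "?C \<subseteq> A"
        using U closedin_diff[OF closedin_topspace, of \<T> U] by (auto simp: topspace)
      have "emeasure N U \<le> emeasure N (\<Omega> - A) + ennreal e"
        using U N[OF Us(1)] N[OF cA] outer_open by auto
      then have "measure N U \<le> measure N (\<Omega> - A) + e"
        using e by (simp add: N.emeasure_eq_measure flip: ennreal_plus)
      then have "measure N A \<le> measure N ?C + e"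
        using N.prob_compl[OF A] N.prob_compl[OF Us(1)] by (simp add: space_N)
      then have "emeasure N A \<le> emeasure N ?C + ennreal e"
        using e by (simp add: N.emeasure_eq_measure ennreal_leI flip: ennreal_plus)
      also have "\<dots> \<le> (SUP C\<in>{C. closedin \<T> C \<and> C \<subseteq> A}. emeasure N C) + ennreal e"
        using C by (intro add_right_mono SUP_upper) auto
      finally show "emeasure N A \<le> (SUP C\<in>{C. closedin \<T> C \<and> C \<subseteq> A}. emeasure N C) + ennreal e" .
    qed
  qed
  have "regular_borel_probability \<T> N"
    unfolding regular_borel_probability_def
    using N.prob_space_axioms space_N sets_N[unfolded \<O>_def] outer_reg inner_reg
    by (intro conjI ballI) (simp_all only: topspace)
  moreover have "measure N B = \<mu> B" if "B \<in> \<B>" for B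
    using N[OF B_sets[OF that]] outer_base[OF that] nonneg[OF that] by (simp add: measure_def)
  ultimately show thesis by (rule that)
qed

text \<open>
  Countable additivity says nothing about an intersection of arbitrarily many clopen sets; outer
  regularity does, since by compactness every open set around the intersection contains the
  intersection of finitely many of them.
\<close>

lemma measure_Inter_eq_one:
  assumes N: "regular_borel_probability \<T> N" and ext: "\<And>B. B \<in> \<B> \<Longrightarrow> measure N B = \<mu> B"
    and F: "\<F> \<subseteq> \<B>" and one: "\<And>B. B \<in> \<F> \<Longrightarrow> \<mu> B = 1"
  shows "measure N (\<Omega> \<inter> \<Inter>\<F>) = 1"
proof -
  interpret N: prob_space N using N by (simp add: regular_borel_probability_def)
  let ?C = "\<Omega> \<inter> \<Inter>\<F>"
  have sets_N: "sets N = sigma_sets \<Omega> {U. openin \<T> U}" and space_N: "space N = \<Omega>"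
    using N by (auto simp: regular_borel_probability_def)
  have O_sets: "U \<in> sets N" if "openin \<T> U" for U using that by (auto simp: sets_N)
  have closed: "closedin \<T> ?C"
  proof (cases "\<F> = {}")
    case True
    then show ?thesis using closedin_topspace[of \<T>] by simp
  next
    case False
    then have "?C = \<Inter>\<F>" using F sets_into_space by blast
    moreover have "closedin \<T> (\<Inter>\<F>)"
      using False F closed_base by (intro closedin_Inter) auto
    ultimately show ?thesis by simp
  qed
  have "\<Omega> - (\<Omega> - ?C) \<in> sets N"
    using closed O_sets[of "\<Omega> - ?C"] sets.compl_sets[of "\<Omega> - ?C" N] by (simp add: closedin_def space_N)
  moreover have "\<Omega> - (\<Omega> - ?C) = ?C" by auto
  ultimately have C: "?C \<in> sets N" by simp
  have "1 \<le> (INF U\<in>{U. openin \<T> U \<and> ?C \<subseteq> U}. emeasure N U)"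
  proof (rule INF_greatest)
    fix U assume "U \<in> {U. openin \<T> U \<and> ?C \<subseteq> U}"
    then have U: "openin \<T> U" "?C \<subseteq> U" by auto
    let ?\<C> = "insert U ((\<lambda>B. \<Omega> - B) ` \<F>)"
    have 1: "compactin \<T> \<Omega>" using compact_space by (simp add: compact_space_def)
    have 2: "openin \<T> V" if "V \<in> ?\<C>" for V
      using that U(1) F open_base[OF compl_sets] by auto
    have 3: "\<Omega> \<subseteq> \<Union>?\<C>" using U(2) by auto
    have "\<exists>\<G>. finite \<G> \<and> \<G> \<subseteq> ?\<C> \<and> \<Omega> \<subseteq> \<Union>\<G>"
      by (rule compactinD[of \<T> \<Omega> ?\<C>, OF 1]) (use 2 3 in simp_all)
    then obtain \<G> where G: "finite \<G>" "\<G> \<subseteq> ?\<C>" "\<Omega> \<subseteq> \<Union>\<G>"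
      by (elim exE conjE)
    then have "finite (\<G> - {U})" "\<G> - {U} \<subseteq> (\<lambda>B. \<Omega> - B) ` \<F>" by auto
    then obtain \<F>' where F': "\<F>' \<subseteq> \<F>" "finite \<F>'" "\<G> - {U} = (\<lambda>B. \<Omega> - B) ` \<F>'"
      using finite_subset_image[of "\<G> - {U}" "\<lambda>B. \<Omega> - B" \<F>] by auto
    have "\<Omega> \<inter> \<Inter>\<F>' \<subseteq> U" 
    proof
      fix x assume x: "x \<in> \<Omega> \<inter> \<Inter>\<F>'"
      then have "x \<notin> \<Union>((\<lambda>B. \<Omega> - B) ` \<F>')" by simp
      then have "x \<notin> \<Union>(\<G> - {U})" using F'(3) by simp
      moreover have "x \<in> \<Union>\<G>" using G(3) x by auto
      ultimately show "x \<in> U" by auto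
    qed
    moreover have "\<mu> (\<Omega> \<inter> \<Inter>\<F>') = 1 \<and> \<Omega> \<inter> \<Inter>\<F>' \<in> \<B>"
    proof (rule finite_Inter_eq_one)
      show "finite \<F>'" "\<F>' \<subseteq> \<B>" using F'(1,2) F by simp_all
      show "\<mu> B = 1" if "B \<in> \<F>'" for B using that F'(1) one by (simp add: subsetD)
    qed
    ultimately have W: "\<Omega> \<inter> \<Inter>\<F>' \<subseteq> U" "\<mu> (\<Omega> \<inter> \<Inter>\<F>') = 1" "\<Omega> \<inter> \<Inter>\<F>' \<in> \<B>"
      by blast+
    have "measure N (\<Omega> \<inter> \<Inter>\<F>') \<le> measure N U"
      using W(1) O_sets[OF U(1)] by (rule N.finite_measure_mono)
    moreover have "measure N (\<Omega> \<inter> \<Inter>\<F>') = 1"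
      using ext[OF W(3)] W(2) by (rule trans)
    ultimately have "1 \<le> measure N U" by linarith
    then show "1 \<le> emeasure N U" by (simp add: N.emeasure_eq_measure)
  qed
  also have "\<dots> = emeasure N ?C"
    using N C unfolding regular_borel_probability_def by (elim conjE ballE) (erule sym, simp)
  finally show ?thesis
    using N.prob_le_1[of ?C] by (simp add: N.emeasure_eq_measure)
qed

end

section \<open>Invariant conditional measures in groups\<close>

context content begin

text \<open>
  Conditioning on the set \<open>\<Inter>\<W>\<close>, which need not belong to \<open>\<B>\<close>: the value at \<open>X\<close> is
  the infimum of \<open>\<mu> (X \<inter> W)\<close> over \<open>W \<in> \<W>\<close>, normalized. The infimum is a limit because \<open>\<W>\<close> is
  directed, hence additive. The last property of \<open>\<nu>\<close> transports symmetries of the pair \<open>\<mu>, \<W>\<close>.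
\<close>

lemma condition_on_filter:
  assumes W: "\<W> \<subseteq> \<B>" and dir: "\<And>W W'. W \<in> \<W> \<Longrightarrow> W' \<in> \<W> \<Longrightarrow> W \<inter> W' \<in> \<W>"
    and ne: "\<W> \<noteq> {}" and pos: "0 < \<epsilon>" "\<And>W. W \<in> \<W> \<Longrightarrow> \<epsilon> \<le> \<mu> W"
  obtains \<nu> where "finitely_additive_prob \<Omega> \<B> \<nu>" "\<And>W. W \<in> \<W> \<Longrightarrow> \<nu> W = 1"
    "\<And>X Y. (\<And>W. W \<in> \<W> \<Longrightarrow> \<exists>W'\<in>\<W>. \<mu> (Y \<inter> W') \<le> \<mu> (X \<inter> W)) \<Longrightarrow>
            X \<in> \<B> \<Longrightarrow> Y \<in> \<B> \<Longrightarrow> \<nu> Y \<le> \<nu> X"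
proof -
  define n where "n X = (INF W\<in>\<W>. \<mu> (X \<inter> W))" for X
  have bdd: "bdd_below ((\<lambda>W. \<mu> (X \<inter> W)) ` \<W>)" if "X \<in> \<B>" for X
    using that W nonneg by (intro bdd_belowI2[where m = 0]) auto
  have lower: "n X \<le> \<mu> (X \<inter> W)" if "X \<in> \<B>" "W \<in> \<W>" for X W
    unfolding n_def using bdd[OF that(1)] that(2) by (rule cINF_lower)
  have greatest: "a \<le> n X" if "\<And>W. W \<in> \<W> \<Longrightarrow> a \<le> \<mu> (X \<inter> W)" for a X
    unfolding n_def using ne that by (rule cINF_greatest)
  have n_nonneg: "0 \<le> n X" if "X \<in> \<B>" for X
    using that W nonneg by (intro greatest) auto
  have n_pos: "\<epsilon> \<le> n \<Omega>"
  proof (rule greatest)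
    fix V assume "V \<in> \<W>"
    then have "\<Omega> \<inter> V = V" using W sets_into_space by auto
    then show "\<epsilon> \<le> \<mu> (\<Omega> \<inter> V)" using pos(2)[OF \<open>V \<in> \<W>\<close>] by simp
  qed
  have n_W: "n V = n \<Omega>" if V: "V \<in> \<W>" for V
  proof (rule antisym)
    show "n V \<le> n \<Omega>"
    proof (rule greatest)
      fix V' assume V': "V' \<in> \<W>"
      have "n V \<le> \<mu> (V \<inter> V')" using V V' W by (intro lower) auto
      also have "\<dots> \<le> \<mu> (\<Omega> \<inter> V')" using V V' W sets_into_space by (intro mono) auto
      finally show "n V \<le> \<mu> (\<Omega> \<inter> V')" .
    qed
    show "n \<Omega> \<le> n V"
    proof (rule greatest)
      fix V' assume V': "V' \<in> \<W>"
      have "\<Omega> \<inter> (V \<inter> V') = V \<inter> V'" using V W sets_into_space by auto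
      then show "n \<Omega> \<le> \<mu> (V \<inter> V')" using lower[OF top dir[OF V V']] by simp
    qed
  qed
  have n_add: "n (X \<union> Y) = n X + n Y" if XY: "X \<in> \<B>" "Y \<in> \<B>" "X \<inter> Y = {}" for X Y
  proof (rule antisym)
    have split: "\<mu> ((X \<union> Y) \<inter> V) = \<mu> (X \<inter> V) + \<mu> (Y \<inter> V)" if "V \<in> \<W>" for V
      unfolding Int_Un_distrib2 using XY that W by (intro add) auto
    show "n X + n Y \<le> n (X \<union> Y)"
      using XY lower by (intro greatest) (simp add: split add_mono)
    have "n (X \<union> Y) - \<mu> (X \<inter> V) \<le> \<mu> (Y \<inter> V')" if V: "V \<in> \<W>" "V' \<in> \<W>" for V V'
    proof -
      have "n (X \<union> Y) \<le> \<mu> ((X \<union> Y) \<inter> (V \<inter> V'))" using XY V dir by (intro lower) auto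
      also have "\<dots> = \<mu> (X \<inter> (V \<inter> V')) + \<mu> (Y \<inter> (V \<inter> V'))" using V dir by (intro split) auto
      also have "\<dots> \<le> \<mu> (X \<inter> V) + \<mu> (Y \<inter> V')"
        using XY V W by (intro add_mono mono) auto
      finally show ?thesis by simp
    qed
    then have "n (X \<union> Y) - \<mu> (X \<inter> V) \<le> n Y" if "V \<in> \<W>" for V
      using that by (intro greatest) auto
    then have "n (X \<union> Y) - n Y \<le> \<mu> (X \<inter> V)" if "V \<in> \<W>" for V
      using that by (simp add: algebra_simps)
    then have "n (X \<union> Y) - n Y \<le> n X" by (intro greatest) auto
    then show "n (X \<union> Y) \<le> n X + n Y" by simp
  qed
  show thesis
  proof (rule that[of "\<lambda>X. n X / n \<Omega>"])
    show "finitely_additive_prob \<Omega> \<B> (\<lambda>X. n X / n \<Omega>)"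
      using n_nonneg n_pos pos(1) n_add by (simp add: finitely_additive_prob_def add_divide_distrib)
    show "n V / n \<Omega> = 1" if "V \<in> \<W>" for V
      using n_W[OF that] n_pos pos(1) by simp
    fix X Y assume XY: "X \<in> \<B>" "Y \<in> \<B>"
      and le: "\<And>W. W \<in> \<W> \<Longrightarrow> \<exists>W'\<in>\<W>. \<mu> (Y \<inter> W') \<le> \<mu> (X \<inter> W)"
    have "n Y \<le> n X"
    proof (rule greatest)
      fix V assume "V \<in> \<W>"
      from le[OF this] obtain V' where "V' \<in> \<W>" "\<mu> (Y \<inter> V') \<le> \<mu> (X \<inter> V)" by auto
      then show "n Y \<le> \<mu> (X \<inter> V)" using lower[OF XY(2)] order_trans by metis
    qed
    then show "n Y / n \<Omega> \<le> n X / n \<Omega>" using n_pos pos(1) by (simp add: divide_right_mono)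
  qed
qed

end

context group begin

text \<open>
  All invariance is expressed with preimages under translations, as this is how translation acts on
  formulas. As sets, \<open>right_pre a X\<close> is \<open>X a^(-1)\<close> and \<open>left_pre c X\<close> is \<open>c^(-1) X\<close>.
\<close>

definition right_pre :: "'a \<Rightarrow> 'a set \<Rightarrow> 'a set" where
  "right_pre a X = {x \<in> carrier G. x \<otimes> a \<in> X}"

definition left_pre :: "'a \<Rightarrow> 'a set \<Rightarrow> 'a set" where
  "left_pre c X = {x \<in> carrier G. c \<otimes> x \<in> X}"

lemma right_pre_right_pre:
  "a \<in> carrier G \<Longrightarrow> b \<in> carrier G \<Longrightarrow> right_pre a (right_pre b X) = right_pre (a \<otimes> b) X"
  by (auto simp: right_pre_def m_assoc)

lemma right_pre_one: "X \<subseteq> carrier G \<Longrightarrow> right_pre \<one> X = X"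
  by (auto simp: right_pre_def)

lemma right_pre_Int: "right_pre a (X \<inter> Y) = right_pre a X \<inter> right_pre a Y"
  by (auto simp: right_pre_def)

lemma left_right_pre:
  "c \<in> carrier G \<Longrightarrow> a \<in> carrier G \<Longrightarrow> left_pre c (right_pre a X) = right_pre a (left_pre c X)"
  by (auto simp: left_pre_def right_pre_def m_assoc)

definition invariant_under :: "'a set \<Rightarrow> 'a set set \<Rightarrow> ('a set \<Rightarrow> real) \<Rightarrow> bool" where
  "invariant_under H \<B> \<mu> \<longleftrightarrow> (\<forall>a\<in>H. \<forall>X\<in>\<B>. \<mu> (right_pre a X) = \<mu> X)"

text \<open>
  Right translations by \<open>H\<close> permute the translates of \<open>V\<close>. Hence conditioning on the intersection of
  all of them yields an \<open>H\<close>-invariant content. The set \<open>P\<close> lies inside every translate and keeps the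
  denominator away from zero.
\<close>

lemma condition_on_translates:
  assumes "content (carrier G) \<B> \<mu>" and H: "subgroup H G"
    and closed: "\<And>a X. a \<in> H \<Longrightarrow> X \<in> \<B> \<Longrightarrow> right_pre a X \<in> \<B>"
    and inv: "invariant_under H \<B> \<mu>"
    and V: "V \<in> \<B>" and P: "P \<in> \<B>" "0 < \<mu> P"
    and PH: "\<And>x h. x \<in> P \<Longrightarrow> h \<in> H \<Longrightarrow> x \<otimes> h \<in> V"
  obtains \<nu> where "finitely_additive_prob (carrier G) \<B> \<nu>" "invariant_under H \<B> \<nu>" "\<nu> V = 1"
proof -
  interpret content "carrier G" \<B> \<mu> by fact
  interpret H: subgroup H G by fact
  define \<W> where "\<W> = {\<Inter>((\<lambda>h. right_pre h V) ` F) |F. finite F \<and> F \<noteq> {} \<and> F \<subseteq> H}"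
  have sub: "X \<subseteq> carrier G" if "X \<in> \<B>" for X using that sets_into_space by auto
  have W: "\<W> \<subseteq> \<B>" unfolding \<W>_def using closed V by (auto intro!: finite_INT)
  have VW: "V \<in> \<W>"
    unfolding \<W>_def using right_pre_one[OF sub[OF V]]
    by (intro CollectI exI[of _ "{\<one>}"]) simp
  have dir: "U \<inter> U' \<in> \<W>" if "U \<in> \<W>" "U' \<in> \<W>" for U U'
  proof -
    obtain F F' where "U = \<Inter>((\<lambda>h. right_pre h V) ` F)" "finite F \<and> F \<noteq> {} \<and> F \<subseteq> H"
      "U' = \<Inter>((\<lambda>h. right_pre h V) ` F')" "finite F' \<and> F' \<noteq> {} \<and> F' \<subseteq> H"
      using \<open>U \<in> \<W>\<close> \<open>U' \<in> \<W>\<close> unfolding \<W>_def by auto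
    then show ?thesis
      unfolding \<W>_def by (intro CollectI exI[of _ "F \<union> F'"]) auto
  qed
  have shift: "right_pre a U \<in> \<W>" if a: "a \<in> H" and U: "U \<in> \<W>" for a U
  proof -
    obtain F where F: "U = \<Inter>((\<lambda>h. right_pre h V) ` F)" "finite F" "F \<noteq> {}" "F \<subseteq> H"
      using U unfolding \<W>_def by auto
    have "right_pre a U = \<Inter>((\<lambda>h. right_pre a (right_pre h V)) ` F)"
      using F(3) by (auto simp: F(1) right_pre_def)
    also have "\<dots> = \<Inter>((\<lambda>h. right_pre h V) ` ((\<lambda>h. a \<otimes> h) ` F))"
      using F(4) a by (simp add: image_image right_pre_right_pre subset_iff cong: INF_cong)
    finally show ?thesis
      unfolding \<W>_def using F a by (intro CollectI exI[of _ "(\<lambda>h. a \<otimes> h) ` F"]) auto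
  qed
  have pos: "\<mu> P \<le> \<mu> U" if "U \<in> \<W>" for U
  proof -
    have "P \<subseteq> U" using that PH sub[OF P(1)] by (auto simp: \<W>_def right_pre_def)
    then show ?thesis using that W P(1) by (intro mono) auto
  qed
  obtain \<nu> where \<nu>: "finitely_additive_prob (carrier G) \<B> \<nu>" "\<And>W. W \<in> \<W> \<Longrightarrow> \<nu> W = 1"
    "\<And>X Y. (\<And>W. W \<in> \<W> \<Longrightarrow> \<exists>W'\<in>\<W>. \<mu> (Y \<inter> W') \<le> \<mu> (X \<inter> W)) \<Longrightarrow>
            X \<in> \<B> \<Longrightarrow> Y \<in> \<B> \<Longrightarrow> \<nu> Y \<le> \<nu> X"
    using condition_on_filter[OF W dir _ P(2) pos] VW by blast
  have le: "\<nu> (right_pre a X) \<le> \<nu> X" if a: "a \<in> H" and X: "X \<in> \<B>" for a X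
  proof (rule \<nu>(3))
    fix U assume U: "U \<in> \<W>"
    have "\<mu> (right_pre a (X \<inter> U)) = \<mu> (X \<inter> U)"
      using inv a X U W by (auto simp: invariant_under_def)
    then have "\<mu> (right_pre a X \<inter> right_pre a U) \<le> \<mu> (X \<inter> U)"
      by (simp add: right_pre_Int)
    then show "\<exists>U'\<in>\<W>. \<mu> (right_pre a X \<inter> U') \<le> \<mu> (X \<inter> U)"
      using shift[OF a U] by (rule bexI)
  qed (use a X closed in auto)
  have "\<nu> (right_pre a X) = \<nu> X" if a: "a \<in> H" and X: "X \<in> \<B>" for a X
  proof (rule antisym[OF le[OF a X]])
    have "right_pre (inv a) (right_pre a X) = X"
      using a sub[OF X] by (simp add: right_pre_right_pre right_pre_one)
    then show "\<nu> X \<le> \<nu> (right_pre a X)"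
      using le[of "inv a" "right_pre a X"] closed[OF a X] a by simp
  qed
  then have "invariant_under H \<B> \<nu>" by (simp add: invariant_under_def)
  with \<nu>(1) show thesis using \<nu>(2)[OF VW] by (rule that)
qed

end

text \<open>
  The contents on \<open>\<B>\<close> form a closed subset of a product of unit intervals, so Tychonoff's theorem
  applies. The conditions may look at \<open>\<nu>\<close> only on \<open>\<B>\<close>, since \<open>\<nu>\<close> is set to zero elsewhere to bring it
  into the product.
\<close>

lemma content_compactness:
  fixes P :: "'i \<Rightarrow> ('b set \<Rightarrow> real) \<Rightarrow> bool"
  assumes alg: "algebra \<Omega> \<B>"
    and clo: "\<And>i. i \<in> I \<Longrightarrow> closed {\<nu>. P i \<nu>}"
    and dep: "\<And>i \<nu> \<nu>'. i \<in> I \<Longrightarrow> (\<And>X. X \<in> \<B> \<Longrightarrow> \<nu> X = \<nu>' X) \<Longrightarrow> P i \<nu> \<Longrightarrow> P i \<nu>'"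
    and fin: "\<And>J. finite J \<Longrightarrow> J \<subseteq> I \<Longrightarrow> \<exists>\<nu>. finitely_additive_prob \<Omega> \<B> \<nu> \<and> (\<forall>i\<in>J. P i \<nu>)"
  shows "\<exists>\<nu>. finitely_additive_prob \<Omega> \<B> \<nu> \<and> (\<forall>i\<in>I. P i \<nu>)"
proof -
  interpret algebra \<Omega> \<B> by fact
  define K :: "('b set \<Rightarrow> real) set" where "K = Pi\<^sub>E UNIV (\<lambda>_. {0..1})"
  define C where "C = K \<inter> {\<nu>. finitely_additive_prob \<Omega> \<B> \<nu>}"
  have "compactin (product_topology (\<lambda>_::'b set. euclideanreal) UNIV) K"
    unfolding K_def by (simp add: compactin_PiE)
  then have "compact K" by (simp add: euclidean_product_topology)
  moreover have "closed {\<nu>. finitely_additive_prob \<Omega> \<B> \<nu>}"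
    unfolding finitely_additive_prob_def Ball_def
    by (intro closed_Collect_conj closed_Collect_all closed_Collect_imp closed_Collect_le
        closed_Collect_eq open_Collect_const continuous_intros continuous_on_product_coordinates)
  ultimately have "compact C" unfolding C_def by (rule compact_Int_closed)
  have "C \<inter> (\<Inter>i\<in>I. {\<nu>. P i \<nu>}) \<noteq> {}"
  proof (rule compact_imp_fip_image[OF \<open>compact C\<close> clo])
    fix J assume J: "finite J" "J \<subseteq> I"
    then obtain \<nu> where \<nu>: "finitely_additive_prob \<Omega> \<B> \<nu>" "\<forall>i\<in>J. P i \<nu>" using fin by blast
    interpret \<nu>: content \<Omega> \<B> \<nu> by unfold_locales fact
    define \<nu>' where "\<nu>' X = (if X \<in> \<B> then \<nu> X else 0)" for X
    have "\<nu>' \<in> K" using \<nu>.nonneg \<nu>.le_one by (auto simp: K_def \<nu>'_def)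
    moreover have "finitely_additive_prob \<Omega> \<B> \<nu>'"
      using \<nu>(1) top by (simp add: finitely_additive_prob_def \<nu>'_def Un)
    moreover have "P i \<nu>'" if "i \<in> J" for i
      using dep[of i \<nu> \<nu>'] that \<nu>(2) J(2) by (auto simp: \<nu>'_def)
    ultimately show "C \<inter> (\<Inter>i\<in>J. {\<nu>. P i \<nu>}) \<noteq> {}" by (auto simp: C_def)
  qed
  then show ?thesis by (auto simp: C_def)
qed

context group begin

text \<open>
  For each \<open>D\<close>, the content conditioned on all right \<open>H\<close>-translates of \<open>c D\<close> is \<open>H\<close>-invariant and
  lives on \<open>c D\<close>; as left and right translations commute, moving it by \<open>c\<close> gives an \<open>H\<close>-invariant
  content living on \<open>D\<close>. A limit of these over the directed family \<open>\<F>\<close> lives on all \<open>D\<close> at once.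
\<close>

theorem invariant_content_on_subgroup:
  assumes "content (carrier G) \<B> \<mu>" and H: "subgroup H G"
    and left: "\<And>c X. c \<in> carrier G \<Longrightarrow> X \<in> \<B> \<Longrightarrow> left_pre c X \<in> \<B>"
    and right: "\<And>a X. a \<in> carrier G \<Longrightarrow> X \<in> \<B> \<Longrightarrow> right_pre a X \<in> \<B>"
    and inv: "invariant_under (carrier G) \<B> \<mu>"
    and \<F>: "\<F> \<subseteq> \<B>" "carrier G \<in> \<F>" "\<And>D E. D \<in> \<F> \<Longrightarrow> E \<in> \<F> \<Longrightarrow> D \<inter> E \<in> \<F>"
    and thick: "\<And>D. D \<in> \<F> \<Longrightarrow> \<exists>E\<in>\<F>. \<forall>x\<in>E. \<forall>h\<in>H. x \<otimes> h \<in> D"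
    and c: "c \<in> carrier G" and pos: "\<And>D. D \<in> \<F> \<Longrightarrow> 0 < \<mu> (left_pre (inv c) D)"
  obtains \<nu> where "finitely_additive_prob (carrier G) \<B> \<nu>" "invariant_under H \<B> \<nu>"
    "\<And>D. D \<in> \<F> \<Longrightarrow> \<nu> D = 1"
proof -
  interpret content "carrier G" \<B> \<mu> by fact
  interpret H: subgroup H G by fact
  have inv_H: "invariant_under H \<B> \<mu>" using inv by (auto simp: invariant_under_def)
  have one: "\<exists>\<nu>. finitely_additive_prob (carrier G) \<B> \<nu> \<and> invariant_under H \<B> \<nu> \<and> \<nu> D = 1"
    if D: "D \<in> \<F>" for D
  proof -
    obtain E where E: "E \<in> \<F>" "\<forall>x\<in>E. \<forall>h\<in>H. x \<otimes> h \<in> D" using thick[OF D] by blast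
    obtain \<rho> where l: "finitely_additive_prob (carrier G) \<B> \<rho>" "invariant_under H \<B> \<rho>"
      "\<rho> (left_pre (inv c) D) = 1"
    proof (rule condition_on_translates[OF \<open>content (carrier G) \<B> \<mu>\<close> H _ inv_H])
      show "left_pre (inv c) D \<in> \<B>" "left_pre (inv c) E \<in> \<B>"
        using left \<F>(1) D E(1) c by auto
      show "0 < \<mu> (left_pre (inv c) E)" using pos E(1) by simp
      show "x \<otimes> h \<in> left_pre (inv c) D" if "x \<in> left_pre (inv c) E" "h \<in> H" for x h
        using that E(2) c by (auto simp: left_pre_def simp flip: m_assoc)
    qed (use right in auto)
    define \<nu> where "\<nu> X = \<rho> (left_pre (inv c) X)" for X
    have "\<nu> (X \<union> Y) = \<nu> X + \<nu> Y" if "X \<in> \<B>" "Y \<in> \<B>" "X \<inter> Y = {}" for X Y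
    proof -
      have "left_pre (inv c) (X \<union> Y) = left_pre (inv c) X \<union> left_pre (inv c) Y"
        "left_pre (inv c) X \<inter> left_pre (inv c) Y = {}"
        using that by (auto simp: left_pre_def)
      then show ?thesis
        using l(1) left[OF _ that(1), of "inv c"] left[OF _ that(2), of "inv c"] c
        by (simp add: \<nu>_def finitely_additive_prob_def)
    qed
    moreover have "left_pre (inv c) (carrier G) = carrier G" using c by (auto simp: left_pre_def)
    ultimately have "finitely_additive_prob (carrier G) \<B> \<nu>"
      using l(1) left[of "inv c"] c by (simp add: \<nu>_def finitely_additive_prob_def)
    moreover have "invariant_under H \<B> \<nu>"
      using l(2) left[of "inv c"] c by (auto simp: \<nu>_def invariant_under_def left_right_pre)
    ultimately show ?thesis using l(3) by (auto simp: \<nu>_def)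
  qed
  define P where "P D \<nu> \<longleftrightarrow> invariant_under H \<B> \<nu> \<and> \<nu> D = 1" for D \<nu>
  have "\<exists>\<nu>. finitely_additive_prob (carrier G) \<B> \<nu> \<and> (\<forall>D\<in>\<F>. P D \<nu>)"
  proof (rule content_compactness)
    show "algebra (carrier G) \<B>" by unfold_locales
    show "closed {\<nu>. P D \<nu>}" for D
      unfolding P_def invariant_under_def Ball_def
      by (intro closed_Collect_conj closed_Collect_all closed_Collect_imp closed_Collect_eq open_Collect_const
          continuous_intros continuous_on_product_coordinates)
    show "P D \<nu>'" if "D \<in> \<F>" "\<And>X. X \<in> \<B> \<Longrightarrow> \<nu> X = \<nu>' X" "P D \<nu>" for D \<nu> \<nu>'
      using that \<F>(1) right by (auto simp: P_def invariant_under_def)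
    fix J assume J: "finite J" "J \<subseteq> \<F>"
    \<comment> \<open>A content living on the smallest set of a finite subfamily serves all its members.\<close>
    have inter: "carrier G \<inter> \<Inter>J \<in> \<F>" using J
      by (induction J rule: finite_induct)
        (use \<F>(2,3) in \<open>auto simp: Int_left_commute\<close>)
    then obtain \<nu> where \<nu>: "finitely_additive_prob (carrier G) \<B> \<nu>" "invariant_under H \<B> \<nu>"
      "\<nu> (carrier G \<inter> \<Inter>J) = 1" using one by blast
    interpret \<nu>: content "carrier G" \<B> \<nu> by unfold_locales fact
    have "\<nu> D = 1" if "D \<in> J" for D
    proof (rule antisym)
      have DB: "D \<in> \<B>" using that J(2) \<F>(1) by auto
      then show "\<nu> D \<le> 1" by (rule \<nu>.le_one)
      have "\<nu> (carrier G \<inter> \<Inter>J) \<le> \<nu> D" using that inter \<F>(1) DB by (intro \<nu>.mono) auto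
      then show "1 \<le> \<nu> D" using \<nu>(3) by simp
    qed
    then show "\<exists>\<nu>. finitely_additive_prob (carrier G) \<B> \<nu> \<and> (\<forall>D\<in>J. P D \<nu>)"
      using \<nu>(1,2) by (auto simp: P_def)
  qed
  then show thesis using that \<F>(2) by (auto simp: P_def)
qed

end

section \<open>Semantics of formulas and definable sets\<close>

lemma eval_trm_cong: "(\<And>v. v \<in> fv_trm t \<Longrightarrow> e v = e' v) \<Longrightarrow> eval_trm M e t = eval_trm M e' t"
proof (induction t)
  case (App f ts)
  have "map (eval_trm M e) ts = map (eval_trm M e') ts"
  proof (rule map_cong[OF refl])
    fix t assume "t \<in> set ts"
    then show "eval_trm M e t = eval_trm M e' t" using App.prems by (intro App.IH) auto
  qed
  then show ?case by (simp del: map_eq_conv)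
qed auto

lemma sat_cong: "(\<And>v. v \<in> fv \<phi> \<Longrightarrow> e v = e' v) \<Longrightarrow> sat M e \<phi> \<longleftrightarrow> sat M e' \<phi>"
proof (induction \<phi> arbitrary: e e')
  case (Eq t u)
  have "eval_trm M e t = eval_trm M e' t" "eval_trm M e u = eval_trm M e' u"
    using Eq by (auto intro!: eval_trm_cong)
  then show ?case by simp
next
  case (Rel r ts)
  have "map (eval_trm M e) ts = map (eval_trm M e') ts"
  proof (rule map_cong[OF refl])
    fix t assume "t \<in> set ts"
    then show "eval_trm M e t = eval_trm M e' t" using Rel by (intro eval_trm_cong) auto
  qed
  then show ?case by (simp del: map_eq_conv)
next
  case (Neg \<phi>)
  from Neg.IH[of e e'] Neg.prems show ?case by simp
next
  case (Conj \<phi> \<psi>)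
  from Conj.IH(1)[of e e'] Conj.IH(2)[of e e'] Conj.prems show ?case by simp
next
  case (Ex v \<phi>)
  have "sat M (e(v := a)) \<phi> \<longleftrightarrow> sat M (e'(v := a)) \<phi>" for a
    using Ex.prems by (intro Ex.IH) auto
  then show ?case by simp
qed

lemma eval_subst_trm: "eval_trm M e (subst_trm v t u) = eval_trm M (e(v := eval_trm M e t)) u"
proof (induction u)
  case (App f ts)
  then have "map (eval_trm M e) (map (subst_trm v t) ts) = map (eval_trm M (e(v := eval_trm M e t))) ts"
    by (simp del: fun_upd_apply)
  then show ?case by (simp only: subst_trm.simps eval_trm.simps)
qed auto

lemma sat_subst:
  assumes "fv_trm t \<subseteq> {v}"
  shows "sat M e (subst v t \<phi>) \<longleftrightarrow> sat M (e(v := eval_trm M e t)) \<phi>"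
proof (induction \<phi> arbitrary: e)
  case (Rel r ts)
  have "map (eval_trm M e) (map (subst_trm v t) ts) = map (eval_trm M (e(v := eval_trm M e t))) ts"
    by (simp add: eval_subst_trm del: fun_upd_apply)
  then show ?case by (simp only: subst.simps sat.simps)
next
  case (Ex w \<phi>)
  show ?case
  proof (cases "w = v")
    case False
    have "eval_trm M (e(w := a)) t = eval_trm M e t" for a
      using assms False by (intro eval_trm_cong) auto
    then show ?thesis using False by (simp add: Ex.IH fun_upd_twist del: fun_upd_apply)
  qed (simp del: fun_upd_apply)
qed (simp_all add: eval_subst_trm del: fun_upd_apply)

lemma has_sort_subst_trm:
  assumes "has_sort L t s"
  shows "has_sort L u s' \<Longrightarrow> has_sort L (subst_trm (s, n) t u) s'"
proof (induction u s' rule: has_sort.induct)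
  case (3 f ts)
  then have "list_all2 (has_sort L) (map (subst_trm (s, n) t) ts) (fargs L f)"
    by (auto simp: list_all2_conv_all_nth)
  with 3 show ?case by (auto intro: has_sort.intros)
qed (use assms in \<open>auto intro: has_sort.intros\<close>)

lemma wf_fm_subst:
  assumes "has_sort L t s"
  shows "wf_fm L \<phi> \<Longrightarrow> wf_fm L (subst (s, n) t \<phi>)"
proof (induction \<phi>)
  case (Eq u u')
  then show ?case using has_sort_subst_trm[OF assms] by auto
next
  case (Rel r ts)
  then show ?case using has_sort_subst_trm[OF assms] by (auto simp: list_all2_conv_all_nth)
qed auto

lemma params_subst_trm: "params_trm (subst_trm v t u) \<subseteq> params_trm u \<union> params_trm t"
  by (induction u) auto

lemma params_subst: "params (subst v t \<phi>) \<subseteq> params \<phi> \<union> params_trm t"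
proof (induction \<phi>)
  case (Eq u u')
  then show ?case using params_subst_trm[of v t u] params_subst_trm[of v t u'] by auto
next
  case (Rel r ts)
  then show ?case using params_subst_trm[of v t] by fastforce
qed auto

lemma fv_subst_trm: "fv_trm (subst_trm v t u) \<subseteq> fv_trm u \<union> fv_trm t"
  by (induction u) auto

lemma fv_subst:
  assumes "fv_trm t \<subseteq> {v}"
  shows "fv (subst v t \<phi>) \<subseteq> fv \<phi> \<union> {v}"
proof (induction \<phi>)
  case (Eq u u')
  then show ?case using assms fv_subst_trm[of v t u] fv_subst_trm[of v t u'] by auto
next
  case (Rel r ts)
  then show ?case using assms fv_subst_trm[of v t] by fastforce
qed auto

definition definable ::
  "('f, 'r, 's) language \<Rightarrow> ('f, 'r, 's, 'a) model \<Rightarrow> ('s \<times> 'a) set \<Rightarrow> 's \<Rightarrow> 'a set set" where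
  "definable L M A s = (\<lambda>\<phi>. realizations M s {\<phi>}) ` forms_x L A s"

lemma definable_mono: "A \<subseteq> B \<Longrightarrow> definable L M A s \<subseteq> definable L M B s"
  by (auto simp: definable_def forms_x_def formulas_def)

lemma realizations_Inter:
  "realizations M s \<Phi> = univ M s \<inter> (\<Inter>\<phi>\<in>\<Phi>. realizations M s {\<phi>})"
  by (auto simp: realizations_def)

lemma Neg_forms_x: "\<phi> \<in> forms_x L A s \<Longrightarrow> Neg \<phi> \<in> forms_x L A s"
  and Conj_forms_x: "\<phi> \<in> forms_x L A s \<Longrightarrow> \<psi> \<in> forms_x L A s \<Longrightarrow> Conj \<phi> \<psi> \<in> forms_x L A s"
  and true_forms_x: "Eq (Var (s, 0)) (Var (s, 0)) \<in> forms_x L A s"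
  by (auto simp: forms_x_def formulas_def intro: has_sort.intros)

locale first_order_structure =
  fixes L :: "('f, 'r, 's) language" and M :: "('f, 'r, 's, 'a) model"
  assumes is_structure: "is_structure L M"
begin

lemma holds_at_iff_sat:
  assumes "\<phi> \<in> forms_x L A s"
  shows "holds_at M s \<phi> (e (s, 0)) \<longleftrightarrow> sat M e \<phi>"
proof -
  have "(\<lambda>v. SOME a. a \<in> univ M (fst v)) \<in> envs M"
    using is_structure by (auto simp: is_structure_def envs_def some_in_eq)
  then have "envs M \<noteq> {}" by auto
  moreover have "sat M (e'((s, 0) := e (s, 0))) \<phi> \<longleftrightarrow> sat M e \<phi>" for e'
    using assms by (intro sat_cong) (auto simp: forms_x_def formulas_def)
  ultimately show ?thesis by (auto simp: holds_at_def)
qed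

lemma realizations_iff:
  assumes "\<phi> \<in> forms_x L A s"
  shows "a \<in> realizations M s {\<phi>} \<longleftrightarrow> a \<in> univ M s \<and> sat M (\<lambda>_. a) \<phi>"
  using holds_at_iff_sat[OF assms, of "\<lambda>_. a"] by (simp add: realizations_def)

lemma sat_iff_realization:
  assumes "\<phi> \<in> forms_x L A s" "e (s, 0) \<in> univ M s"
  shows "sat M e \<phi> \<longleftrightarrow> e (s, 0) \<in> realizations M s {\<phi>}"
  using holds_at_iff_sat[OF assms(1), of e] assms(2) by (simp add: realizations_def)

lemma holds_at_Neg: "\<phi> \<in> forms_x L A s \<Longrightarrow> holds_at M s (Neg \<phi>) a \<longleftrightarrow> \<not> holds_at M s \<phi> a"
  using holds_at_iff_sat[of \<phi> A s "\<lambda>_. a"] holds_at_iff_sat[of "Neg \<phi>" A s "\<lambda>_. a"]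
  by (simp add: Neg_forms_x)

lemma holds_at_Conj:
  "\<phi> \<in> forms_x L A s \<Longrightarrow> \<psi> \<in> forms_x L A s \<Longrightarrow>
    holds_at M s (Conj \<phi> \<psi>) a \<longleftrightarrow> holds_at M s \<phi> a \<and> holds_at M s \<psi> a"
  using holds_at_iff_sat[of \<phi> A s "\<lambda>_. a"] holds_at_iff_sat[of \<psi> A s "\<lambda>_. a"]
    holds_at_iff_sat[of "Conj \<phi> \<psi>" A s "\<lambda>_. a"]
  by (simp add: Conj_forms_x)

lemma realizations_Neg:
  "\<phi> \<in> forms_x L A s \<Longrightarrow> realizations M s {Neg \<phi>} = univ M s - realizations M s {\<phi>}"
  by (auto simp: realizations_def holds_at_Neg)

lemma realizations_Conj:
  "\<phi> \<in> forms_x L A s \<Longrightarrow> \<psi> \<in> forms_x L A s \<Longrightarrow>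
    realizations M s {Conj \<phi> \<psi>} = realizations M s {\<phi>} \<inter> realizations M s {\<psi>}"
  by (auto simp: realizations_def holds_at_Conj)

lemma realizations_Disj:
  "\<phi> \<in> forms_x L A s \<Longrightarrow> \<psi> \<in> forms_x L A s \<Longrightarrow>
    realizations M s {Disj \<phi> \<psi>} = realizations M s {\<phi>} \<union> realizations M s {\<psi>}"
proof -
  assume F: "\<phi> \<in> forms_x L A s" "\<psi> \<in> forms_x L A s"
  note N = F[THEN Neg_forms_x]
  show ?thesis
    using realizations_Neg[OF Conj_forms_x[OF N]] realizations_Conj[OF N] F[THEN realizations_Neg]
    by (auto simp: realizations_def)
qed

lemma realizations_true: "realizations M s {Eq (Var (s, 0)) (Var (s, 0))} = univ M s"
  by (auto simp: realizations_def holds_at_def)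

lemma algebra_definable: "algebra (univ M s) (definable L M A s)"
  unfolding algebra_iff_Int
proof (intro conjI ballI)
  show "definable L M A s \<subseteq> Pow (univ M s)" by (auto simp: definable_def realizations_def)
  have "{} = realizations M s {Neg (Eq (Var (s, 0)) (Var (s, 0)))}"
    using realizations_Neg[OF true_forms_x[of s L A]] realizations_true[of s] by simp
  then show "{} \<in> definable L M A s"
    unfolding definable_def by (rule image_eqI) (intro Neg_forms_x true_forms_x)
  fix X assume "X \<in> definable L M A s"
  then obtain \<phi> where p: "\<phi> \<in> forms_x L A s" "X = realizations M s {\<phi>}"
    by (auto simp: definable_def)
  then show "univ M s - X \<in> definable L M A s"
    unfolding definable_def by (intro image_eqI[of _ _ "Neg \<phi>"]) (simp_all add: realizations_Neg Neg_forms_x)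
  fix Y assume "Y \<in> definable L M A s"
  then obtain \<psi> where "\<psi> \<in> forms_x L A s" "Y = realizations M s {\<psi>}"
    by (auto simp: definable_def)
  with p show "X \<inter> Y \<in> definable L M A s"
    unfolding definable_def
    by (intro image_eqI[of _ _ "Conj \<phi> \<psi>"]) (simp_all add: realizations_Conj Conj_forms_x)
qed

text \<open>
  Saturation in terms of definable sets. Only the set of parameters has to be small; the family
  itself may have any size.
\<close>

lemma saturated_definable_family:
  assumes sat: "saturated L \<kappa> M" and A: "A \<subseteq> elts M" "|A| <o \<kappa>"
    and T: "\<And>i. i \<in> I \<Longrightarrow> T i \<in> definable L M A s"
    and fin: "\<And>J. finite J \<Longrightarrow> J \<subseteq> I \<Longrightarrow> \<exists>a\<in>univ M s. \<forall>i\<in>J. a \<in> T i"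
  shows "\<exists>a\<in>univ M s. \<forall>i\<in>I. a \<in> T i"
proof -
  have "\<forall>i\<in>I. \<exists>\<phi>. \<phi> \<in> forms_x L A s \<and> realizations M s {\<phi>} = T i"
  proof
    fix i assume "i \<in> I"
    from T[OF this] show "\<exists>\<phi>. \<phi> \<in> forms_x L A s \<and> realizations M s {\<phi>} = T i"
      unfolding definable_def by (elim imageE) auto
  qed
  then obtain f where f: "\<forall>i\<in>I. f i \<in> forms_x L A s \<and> realizations M s {f i} = T i"
    by (auto dest: bchoice)
  have r: "realizations M s (f ` J) = univ M s \<inter> (\<Inter>i\<in>J. T i)" if "J \<subseteq> I" for J
    unfolding realizations_Inter[of M s "f ` J"] using f that by (auto simp: subset_iff)
  have "finitely_satisfiable M s (f ` I)"
    unfolding finitely_satisfiable_def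
  proof (intro allI impI)
    fix \<Psi> assume "\<Psi> \<subseteq> f ` I" "finite \<Psi>"
    then obtain J where J: "J \<subseteq> I" "finite J" "\<Psi> = f ` J" using finite_subset_image[of \<Psi> f I] by auto
    show "realizations M s \<Psi> \<noteq> {}" unfolding J(3) r[OF J(1)] using fin[OF J(2,1)] by auto
  qed
  moreover have "f ` I \<subseteq> forms_x L A s" using f by auto
  ultimately have "realizations M s (f ` I) \<noteq> {}"
    using sat A unfolding saturated_def by simp
  then show ?thesis unfolding r[OF subset_refl] by auto
qed

section \<open>The type space\<close>

text \<open>
  A maximal finitely satisfiable set of formulas decides every formula: otherwise finitely many of
  its members would contradict \<open>\<phi>\<close> and finitely many would contradict its negation.
\<close>

lemma complete_type_extension:
  assumes P: "\<Phi> \<subseteq> forms_x L (elts M) s" "finitely_satisfiable M s \<Phi>"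
  obtains p where "p \<in> type_space L M s" "\<Phi> \<subseteq> p"
proof -
  let ?F = "forms_x L (elts M) s"
  define \<A> where "\<A> = {\<Psi>. \<Phi> \<subseteq> \<Psi> \<and> \<Psi> \<subseteq> ?F \<and> finitely_satisfiable M s \<Psi>}"
  have "\<exists>p\<in>\<A>. \<forall>\<Psi>\<in>\<A>. p \<subseteq> \<Psi> \<longrightarrow> \<Psi> = p"
  proof (rule subset_Zorn_nonempty)
    show "\<A> \<noteq> {}" using P by (auto simp: \<A>_def)
    fix \<C> assume C: "\<C> \<noteq> {}" "subset.chain \<A> \<C>"
    have sub: "\<C> \<subseteq> \<A>" using C(2) by (simp add: subset.chain_def)
    have "finitely_satisfiable M s (\<Union>\<C>)"
      unfolding finitely_satisfiable_def
    proof (intro allI impI)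
      fix \<Psi> assume "\<Psi> \<subseteq> \<Union>\<C>" "finite \<Psi>"
      then obtain \<Theta> where "\<Theta> \<in> \<C>" "\<Psi> \<subseteq> \<Theta>"
        using finite_subset_Union_chain[OF _ _ C(1,2)] by metis
      then show "realizations M s \<Psi> \<noteq> {}"
        using sub \<open>finite \<Psi>\<close> by (auto simp: \<A>_def finitely_satisfiable_def)
    qed
    then show "\<Union>\<C> \<in> \<A>" using C(1) sub by (auto simp: \<A>_def)
  qed
  then obtain p where p: "p \<in> \<A>" and max: "\<forall>\<Psi>\<in>\<A>. p \<subseteq> \<Psi> \<longrightarrow> \<Psi> = p" by blast
  have witness: "\<exists>\<Psi>\<subseteq>p. finite \<Psi> \<and> realizations M s (insert \<phi> \<Psi>) = {}"
    if "\<phi> \<in> ?F" "\<phi> \<notin> p" for \<phi>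
  proof -
    have "insert \<phi> p \<notin> \<A>" using max that(2) by (metis insertI1 subset_insertI)
    then have "\<not> finitely_satisfiable M s (insert \<phi> p)" using p that(1) by (auto simp: \<A>_def)
    then obtain \<Psi> where Y: "\<Psi> \<subseteq> insert \<phi> p" "finite \<Psi>" "realizations M s \<Psi> = {}"
      by (auto simp: finitely_satisfiable_def)
    then have "realizations M s (insert \<phi> (\<Psi> - {\<phi>})) = {}" by (auto simp: realizations_def)
    then show ?thesis using Y by (intro exI[of _ "\<Psi> - {\<phi>}"]) auto
  qed
  have "\<phi> \<in> p \<or> Neg \<phi> \<in> p" if F: "\<phi> \<in> ?F" for \<phi>
  proof (rule ccontr)
    assume "\<not> (\<phi> \<in> p \<or> Neg \<phi> \<in> p)"
    then obtain \<Psi> \<Psi>' where Y: "\<Psi> \<subseteq> p" "finite \<Psi>" "realizations M s (insert \<phi> \<Psi>) = {}"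
      "\<Psi>' \<subseteq> p" "finite \<Psi>'" "realizations M s (insert (Neg \<phi>) \<Psi>') = {}"
      using witness[OF F] witness[OF Neg_forms_x[OF F]] by auto
    then have "realizations M s (\<Psi> \<union> \<Psi>') \<noteq> {}"
      using p by (simp add: \<A>_def finitely_satisfiable_def)
    then obtain a where "a \<in> realizations M s (\<Psi> \<union> \<Psi>')" by auto
    then have "a \<in> realizations M s (insert \<phi> \<Psi>) \<or> a \<in> realizations M s (insert (Neg \<phi>) \<Psi>')"
      using F by (auto simp: realizations_def holds_at_Neg)
    then show False using Y(3,6) by simp
  qed
  then have "p \<in> type_space L M s" using p by (auto simp: type_space_def \<A>_def)
  then show thesis using p by (intro that) (auto simp: \<A>_def)
qed

lemma type_finite:
  "p \<in> type_space L M s \<Longrightarrow> \<Psi> \<subseteq> p \<Longrightarrow> finite \<Psi> \<Longrightarrow> realizations M s \<Psi> \<noteq> {}"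
  by (auto simp: type_space_def finitely_satisfiable_def)

lemma Neg_in_type:
  assumes "p \<in> type_space L M s" "\<phi> \<in> forms_x L (elts M) s"
  shows "Neg \<phi> \<in> p \<longleftrightarrow> \<phi> \<notin> p"
proof -
  have "realizations M s {\<phi>, Neg \<phi>} = {}" using assms(2) by (auto simp: realizations_def holds_at_Neg)
  then show ?thesis using type_finite[OF assms(1), of "{\<phi>, Neg \<phi>}"] assms by (auto simp: type_space_def)
qed

lemma Conj_in_type:
  assumes p: "p \<in> type_space L M s" and F: "\<phi> \<in> forms_x L (elts M) s" "\<psi> \<in> forms_x L (elts M) s"
  shows "Conj \<phi> \<psi> \<in> p \<longleftrightarrow> \<phi> \<in> p \<and> \<psi> \<in> p"
proof -
  let ?C = "Conj \<phi> \<psi>"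
  have C: "?C \<in> forms_x L (elts M) s" using F by (rule Conj_forms_x)
  have "realizations M s {\<phi>, \<psi>, Neg ?C} = {}" "realizations M s {Neg \<phi>, ?C} = {}"
    "realizations M s {Neg \<psi>, ?C} = {}"
    using F C by (auto simp: realizations_def holds_at_Neg holds_at_Conj)
  then show ?thesis
    using type_finite[OF p, of "{\<phi>, \<psi>, Neg ?C}"] type_finite[OF p, of "{Neg \<phi>, ?C}"]
      type_finite[OF p, of "{Neg \<psi>, ?C}"] Neg_in_type[OF p F(1)] Neg_in_type[OF p F(2)]
      Neg_in_type[OF p C] by auto
qed

abbreviation tp :: "'s \<Rightarrow> 'a \<Rightarrow> ('f, 'r, 's, 's \<times> 'a) fm set" where
  "tp s a \<equiv> {\<phi> \<in> forms_x L (elts M) s. holds_at M s \<phi> a}"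

lemma tp_in_type_space:
  assumes "a \<in> univ M s"
  shows "tp s a \<in> type_space L M s"
proof -
  have "a \<in> realizations M s \<Psi>" if "\<Psi> \<subseteq> tp s a" for \<Psi> using assms that by (auto simp: realizations_def)
  then have "finitely_satisfiable M s (tp s a)" by (auto simp: finitely_satisfiable_def)
  then show ?thesis by (auto simp: type_space_def holds_at_Neg Neg_forms_x)
qed

abbreviation basic :: "'s \<Rightarrow> ('f, 'r, 's, 's \<times> 'a) fm set set set" where
  "basic s \<equiv> (\<lambda>\<phi>. types_containing L M s {\<phi>}) ` forms_x L (elts M) s"

lemma types_containing_Neg: "\<phi> \<in> forms_x L (elts M) s \<Longrightarrow>
  types_containing L M s {Neg \<phi>} = type_space L M s - types_containing L M s {\<phi>}"
  by (auto simp: types_containing_def Neg_in_type)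

lemma types_containing_Conj: "\<phi> \<in> forms_x L (elts M) s \<Longrightarrow> \<psi> \<in> forms_x L (elts M) s \<Longrightarrow>
  types_containing L M s {Conj \<phi> \<psi>} = types_containing L M s {\<phi>} \<inter> types_containing L M s {\<psi>}"
  by (auto simp: types_containing_def Conj_in_type)

lemma types_containing_true:
  "types_containing L M s {Eq (Var (s, 0)) (Var (s, 0))} = type_space L M s"
proof -
  let ?t = "Eq (Var (s, 0)) (Var (s, 0))"
  have "?t \<in> p" if p: "p \<in> type_space L M s" for p
  proof (rule ccontr)
    assume "?t \<notin> p"
    then have "Neg ?t \<in> p" using Neg_in_type[OF p true_forms_x] by simp
    then have "realizations M s {Neg ?t} \<noteq> {}" using type_finite[OF p, of "{Neg ?t}"] by simp
    then show False using realizations_Neg[OF true_forms_x[of s L "{}"]] realizations_true[of s] by simp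
  qed
  then show ?thesis by (auto simp: types_containing_def)
qed

lemma algebra_basic: "algebra (type_space L M s) (basic s)"
  unfolding algebra_iff_Int
proof (intro conjI ballI)
  show "basic s \<subseteq> Pow (type_space L M s)" by (auto simp: types_containing_def)
  have "{} = types_containing L M s {Neg (Eq (Var (s, 0)) (Var (s, 0)))}"
    using types_containing_Neg[OF true_forms_x[of s]] types_containing_true[of s] by simp
  then show "{} \<in> basic s"
    by (rule image_eqI) (intro Neg_forms_x true_forms_x)
  fix X assume "X \<in> basic s"
  then obtain \<phi> where p: "\<phi> \<in> forms_x L (elts M) s" "X = types_containing L M s {\<phi>}" by auto
  then show "type_space L M s - X \<in> basic s"
    by (intro image_eqI[of _ _ "Neg \<phi>"]) (simp_all add: types_containing_Neg Neg_forms_x)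
  fix Y assume "Y \<in> basic s"
  then obtain \<psi> where "\<psi> \<in> forms_x L (elts M) s" "Y = types_containing L M s {\<psi>}" by auto
  with p show "X \<inter> Y \<in> basic s"
    by (intro image_eqI[of _ _ "Conj \<phi> \<psi>"]) (simp_all add: types_containing_Conj Conj_forms_x)
qed

lemma type_space_compact:
  assumes C: "\<C> \<subseteq> basic s" "\<Union>\<C> = type_space L M s"
  shows "\<exists>\<F>\<subseteq>\<C>. finite \<F> \<and> \<Union>\<F> = type_space L M s"
proof -
  define \<Phi> where "\<Phi> = {\<phi> \<in> forms_x L (elts M) s. types_containing L M s {\<phi>} \<in> \<C>}"
  have "\<not> finitely_satisfiable M s (Neg ` \<Phi>)"
  proof
    assume "finitely_satisfiable M s (Neg ` \<Phi>)"
    moreover have "Neg ` \<Phi> \<subseteq> forms_x L (elts M) s" by (auto simp: \<Phi>_def Neg_forms_x)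
    ultimately obtain p where p: "p \<in> type_space L M s" "Neg ` \<Phi> \<subseteq> p"
      using complete_type_extension by metis
    then have "p \<in> \<Union>\<C>" using C(2) by simp
    then obtain B where "B \<in> \<C>" "p \<in> B" by (rule UnionE)
    moreover obtain \<phi> where "\<phi> \<in> forms_x L (elts M) s" "B = types_containing L M s {\<phi>}"
      using C(1) \<open>B \<in> \<C>\<close> by auto
    ultimately have "\<phi> \<in> \<Phi>" "\<phi> \<in> p" "\<phi> \<in> forms_x L (elts M) s"
      by (auto simp: \<Phi>_def types_containing_def)
    then show False using p Neg_in_type[OF p(1), of \<phi>] by auto
  qed
  then obtain \<Theta> where "\<Theta> \<subseteq> Neg ` \<Phi>" "finite \<Theta>" "realizations M s \<Theta> = {}"
    by (auto simp: finitely_satisfiable_def)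
  then obtain \<Psi> where Y: "\<Psi> \<subseteq> \<Phi>" "finite \<Psi>" "realizations M s (Neg ` \<Psi>) = {}"
    using finite_subset_image[of \<Theta> Neg \<Phi>] by auto
  let ?\<F> = "(\<lambda>\<phi>. types_containing L M s {\<phi>}) ` \<Psi>"
  have "p \<in> \<Union>?\<F>" if p: "p \<in> type_space L M s" for p
  proof (rule ccontr)
    assume "p \<notin> \<Union>?\<F>"
    then have "Neg ` \<Psi> \<subseteq> p"
      using p Y(1) Neg_in_type[OF p] by (auto simp: types_containing_def \<Phi>_def)
    then show False using type_finite[OF p, of "Neg ` \<Psi>"] Y by simp
  qed
  then have "\<Union>?\<F> = type_space L M s" by (auto simp: types_containing_def)
  then show ?thesis using Y(1,2) by (intro exI[of _ ?\<F>]) (auto simp: \<Phi>_def)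
qed

text \<open>
  Sending \<open>a\<close> to its type over the whole structure pulls the clopen set of \<open>\<phi>\<close> back to the
  realizations of \<open>\<phi>\<close>. So a content on definable sets is the same as a content on clopen sets of
  types, and the extension theorem for compact clopen bases applies.
\<close>

theorem borel_extension_exists:
  assumes "content (univ M s) (definable L M (elts M) s) \<nu>"
  obtains N where "borel_extension L M s (\<lambda>\<phi>. \<nu> (realizations M s {\<phi>})) N"
    "\<And>\<Phi>. \<Phi> \<subseteq> forms_x L (elts M) s \<Longrightarrow> (\<And>\<phi>. \<phi> \<in> \<Phi> \<Longrightarrow> \<nu> (realizations M s {\<phi>}) = 1) \<Longrightarrow>
      measure N (types_containing L M s \<Phi>) = 1"
proof -
  interpret \<nu>: content "univ M s" "definable L M (elts M) s" \<nu> by fact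
  define \<beta> where "\<beta> B = \<nu> {a \<in> univ M s. tp s a \<in> B}" for B
  have pre: "{a \<in> univ M s. tp s a \<in> types_containing L M s {\<phi>}} = realizations M s {\<phi>}"
    if "\<phi> \<in> forms_x L (elts M) s" for \<phi>
    using that tp_in_type_space by (auto simp: types_containing_def realizations_def)
  have b: "\<beta> (types_containing L M s {\<phi>}) = \<nu> (realizations M s {\<phi>})"
    if "\<phi> \<in> forms_x L (elts M) s" for \<phi> using pre[OF that] by (simp add: \<beta>_def)
  have pre': "{a \<in> univ M s. tp s a \<in> B} \<in> definable L M (elts M) s" if B: "B \<in> basic s" for B
  proof -
    obtain \<phi> where "\<phi> \<in> forms_x L (elts M) s" "B = types_containing L M s {\<phi>}" using B by auto
    then show ?thesis unfolding definable_def using pre[of \<phi>] by (intro image_eqI[of _ _ \<phi>]) simp_all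
  qed
  have "{a \<in> univ M s. tp s a \<in> type_space L M s} = univ M s" using tp_in_type_space by auto
  moreover have "\<beta> (B \<union> B') = \<beta> B + \<beta> B'" if "B \<in> basic s" "B' \<in> basic s" "B \<inter> B' = {}" for B B'
  proof -
    have "{a \<in> univ M s. tp s a \<in> B \<union> B'} = {a \<in> univ M s. tp s a \<in> B} \<union> {a \<in> univ M s. tp s a \<in> B'}"
      by auto
    then show ?thesis
      unfolding \<beta>_def using pre'[OF that(1)] pre'[OF that(2)] that(3)
      by (simp only:) (intro \<nu>.add, auto)
  qed
  ultimately have "finitely_additive_prob (type_space L M s) (basic s) \<beta>"
    unfolding finitely_additive_prob_def using \<nu>.nonneg[OF pre'] \<nu>.total by (simp add: \<beta>_def)
  then interpret T: compact_content "type_space L M s" "basic s" \<beta>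
    using algebra_basic[of s] type_space_compact[of _ s]
    by (simp add: compact_content_def content_def compact_content_axioms_def content_axioms_def)
  obtain N where N: "regular_borel_probability (topology_generated_by (basic s)) N"
    "\<And>B. B \<in> basic s \<Longrightarrow> measure N B = \<beta> B" using T.regular_borel_extension by metis
  show thesis
  proof (rule that)
    show "borel_extension L M s (\<lambda>\<phi>. \<nu> (realizations M s {\<phi>})) N"
      unfolding borel_extension_def type_topology_def using N b by simp
    fix \<Phi> assume P: "\<Phi> \<subseteq> forms_x L (elts M) s" "\<And>\<phi>. \<phi> \<in> \<Phi> \<Longrightarrow> \<nu> (realizations M s {\<phi>}) = 1"
    let ?\<F> = "(\<lambda>\<phi>. types_containing L M s {\<phi>}) ` \<Phi>"
    have "measure N (type_space L M s \<inter> \<Inter>?\<F>) = 1"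
    proof (rule T.measure_Inter_eq_one[OF N])
      show "?\<F> \<subseteq> basic s" using P(1) by auto
      show "\<beta> B = 1" if "B \<in> ?\<F>" for B using that P b by auto
    qed
    moreover have "type_space L M s \<inter> \<Inter>?\<F> = types_containing L M s \<Phi>"
      by (auto simp: types_containing_def)
    ultimately show "measure N (types_containing L M s \<Phi>) = 1" by simp
  qed
qed

end

section \<open>Definable sets in an expansion of a group\<close>

locale definable_group = first_order_structure L M
  for L :: "('f, 'r, 's) language" and M :: "('f, 'r, 's, 'a) model" +
  fixes g :: 's and m :: 'f
  assumes expands: "expands_group L M g m"
begin

abbreviation G where "G \<equiv> group_of M g m"

sublocale G: group G
  using expands by (simp add: expands_group_def)

lemma carrier_G: "carrier G = univ M g" and mult_G: "x \<otimes>\<^bsub>G\<^esub> y = fint M m [x, y]"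
  by (simp_all add: group_of_def)

lemma has_sort_product:
  "has_sort L t g \<Longrightarrow> has_sort L u g \<Longrightarrow> has_sort L (App m [t, u]) g"
  using expands has_sort.intros(3)[of m L "[t, u]"] by (simp add: expands_group_def)

lemma definableI:
  assumes "\<phi> \<in> forms_x L A g" "X \<subseteq> univ M g" "\<And>a. a \<in> univ M g \<Longrightarrow> sat M (\<lambda>_. a) \<phi> \<longleftrightarrow> a \<in> X"
  shows "X \<in> definable L M A g"
proof -
  have "X = realizations M g {\<phi>}"
    using assms(2,3) realizations_iff[OF assms(1)] by auto
  then show ?thesis using assms(1) unfolding definable_def by (rule image_eqI)
qed

lemma translate_forms_x:
  assumes "\<phi> \<in> forms_x L A g" "A \<subseteq> elts M" "a \<in> carrier G"
  shows "translate g m a \<phi> \<in> forms_x L (elts M) g"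
proof -
  let ?t = "App m [Var (g, 0), Par (g, a)] :: ('f, 's, 's \<times> 'a) trm"
  have "has_sort L ?t g" by (intro has_sort_product has_sort.intros)
  moreover have "params_trm ?t \<subseteq> elts M" using assms(3) by (simp add: elts_def carrier_G)
  ultimately show ?thesis
    using assms params_subst[of "(g, 0)" ?t \<phi>] fv_subst[of ?t "(g, 0)" \<phi>] wf_fm_subst[of L ?t g \<phi> 0]
    unfolding translate_def forms_x_def formulas_def by auto
qed

lemma realizations_translate:
  assumes F: "\<phi> \<in> forms_x L (elts M) g" and a: "a \<in> carrier G"
  shows "realizations M g {translate g m a \<phi>} = G.right_pre a (realizations M g {\<phi>})"
proof -
  have "sat M (\<lambda>_. x) (translate g m a \<phi>) \<longleftrightarrow> x \<otimes>\<^bsub>G\<^esub> a \<in> realizations M g {\<phi>}"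
    if "x \<in> carrier G" for x
  proof -
    have "x \<otimes>\<^bsub>G\<^esub> a \<in> univ M g" using that a G.m_closed carrier_G by auto
    then show ?thesis
      using sat_iff_realization[OF F, of "(\<lambda>_. x)((g, 0) := x \<otimes>\<^bsub>G\<^esub> a)"]
      by (simp add: translate_def sat_subst mult_G)
  qed
  then show ?thesis
    using realizations_iff[OF translate_forms_x[OF F subset_refl a]]
    by (auto simp: G.right_pre_def carrier_G)
qed

lemma right_pre_definable:
  assumes "X \<in> definable L M (elts M) g" "a \<in> carrier G"
  shows "G.right_pre a X \<in> definable L M (elts M) g"
proof -
  obtain \<phi> where F: "\<phi> \<in> forms_x L (elts M) g" "X = realizations M g {\<phi>}"
    using assms(1) by (auto simp: definable_def)
  show ?thesis
    unfolding definable_def F(2) realizations_translate[OF F(1) assms(2), symmetric]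
    using translate_forms_x[OF F(1) subset_refl assms(2)] by (rule imageI)
qed

text \<open>
  The variable \<open>(g, 0)\<close> is quantified again inside the formula, in place of substituting \<open>c \<cdot> x\<close> for it:
  the inner quantifier copies the product back into \<open>(g, 0)\<close>, so bound variables of \<open>\<phi>\<close> cannot
  capture anything.
\<close>

lemma left_pre_definable:
  assumes "X \<in> definable L M A g" "c \<in> carrier G"
  shows "G.left_pre c X \<in> definable L M (insert (g, c) A) g"
proof -
  obtain \<phi> where F: "\<phi> \<in> forms_x L A g" "X = realizations M g {\<phi>}"
    using assms(1) by (auto simp: definable_def)
  let ?\<psi> = "Ex (g, 1) (Conj (Eq (Var (g, 1)) (App m [Par (g, c), Var (g, 0)]))
      (Ex (g, 0) (Conj (Eq (Var (g, 0)) (Var (g, 1))) \<phi>)))"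
  show ?thesis
  proof (rule definableI[of ?\<psi>])
    have "has_sort L (App m [Par (g, c), Var (g, 0)]) g"
      by (intro has_sort_product has_sort.intros)
    then show "?\<psi> \<in> forms_x L (insert (g, c) A) g"
      using F(1) by (auto simp: forms_x_def formulas_def intro: has_sort.intros)
    show "G.left_pre c X \<subseteq> univ M g" by (auto simp: G.left_pre_def carrier_G)
    fix x assume x: "x \<in> univ M g"
    have cx: "fint M m [c, x] \<in> univ M g"
      using G.m_closed[of c x] x assms(2) by (simp add: carrier_G mult_G)
    show "sat M (\<lambda>_. x) ?\<psi> \<longleftrightarrow> x \<in> G.left_pre c X"
      using x cx sat_iff_realization[OF F(1), of "(\<lambda>_. x)((g, 1) := fint M m [c, x], (g, 0) := fint M m [c, x])"]
      by (auto simp: G.left_pre_def carrier_G mult_G F(2))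
  qed
qed

text \<open>
  The same reuse of \<open>(g, 0)\<close> lets it stand for \<open>x\<close>, then \<open>y\<close>, then their product; the value of \<open>x\<close> is
  first saved in \<open>(g, 2)\<close> and the product passed on in \<open>(g, 1)\<close>.
\<close>

lemma projection_definable:
  assumes "P \<in> definable L M A g" "D \<in> definable L M A g"
  shows "{x \<in> carrier G. \<exists>y\<in>P. x \<otimes>\<^bsub>G\<^esub> y \<notin> D} \<in> definable L M A g"
proof -
  obtain \<psi> where P: "\<psi> \<in> forms_x L A g" "P = realizations M g {\<psi>}"
    using assms(1) by (auto simp: definable_def)
  obtain \<phi> where D: "\<phi> \<in> forms_x L A g" "D = realizations M g {\<phi>}"
    using assms(2) by (auto simp: definable_def)
  let ?\<chi> = "Ex (g, 1) (Conj (Eq (Var (g, 1)) (App m [Var (g, 2), Var (g, 0)]))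
      (Ex (g, 0) (Conj (Eq (Var (g, 0)) (Var (g, 1))) (Neg \<phi>))))"
  let ?\<theta> = "Ex (g, 2) (Conj (Eq (Var (g, 2)) (Var (g, 0))) (Ex (g, 0) (Conj \<psi> ?\<chi>)))"
  have P_sub: "P \<subseteq> univ M g" by (auto simp: P(2) realizations_def)
  show ?thesis
  proof (rule definableI[of ?\<theta>])
    have "has_sort L (App m [Var (g, 2), Var (g, 0)]) g"
      by (intro has_sort_product has_sort.intros)
    then show "?\<theta> \<in> forms_x L A g"
      using P(1) D(1) by (auto simp: forms_x_def formulas_def intro: has_sort.intros)
    show "{x \<in> carrier G. \<exists>y\<in>P. x \<otimes>\<^bsub>G\<^esub> y \<notin> D} \<subseteq> univ M g" by (auto simp: carrier_G)
    fix x assume x: "x \<in> univ M g"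
    let ?e = "\<lambda>y. (\<lambda>_. x)((g, 2) := x, (g, 0) := y)"
    have chi: "sat M (?e y) ?\<chi> \<longleftrightarrow> fint M m [x, y] \<notin> D" if y: "y \<in> univ M g" for y
    proof -
      let ?z = "fint M m [x, y]"
      have z: "?z \<in> univ M g" using G.m_closed[of x y] x y by (simp add: carrier_G mult_G)
      have "sat M (?e y) ?\<chi> \<longleftrightarrow> \<not> sat M ((?e y)((g, 1) := ?z, (g, 0) := ?z)) \<phi>"
        using z by auto
      also have "\<dots> \<longleftrightarrow> ?z \<notin> D"
        using z sat_iff_realization[OF D(1), of "(?e y)((g, 1) := ?z, (g, 0) := ?z)"] by (simp add: D(2))
      finally show ?thesis .
    qed
    have "sat M (\<lambda>_. x) ?\<theta> \<longleftrightarrow> (\<exists>y\<in>univ M g. sat M (?e y) \<psi> \<and> sat M (?e y) ?\<chi>)"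
      using x by simp
    also have "\<dots> \<longleftrightarrow> (\<exists>y\<in>univ M g. y \<in> P \<and> fint M m [x, y] \<notin> D)"
      using chi sat_iff_realization[OF P(1), of "?e _"] by (intro bex_cong refl) (simp add: P(2))
    also have "\<dots> \<longleftrightarrow> x \<in> {x \<in> carrier G. \<exists>y\<in>P. x \<otimes>\<^bsub>G\<^esub> y \<notin> D}"
      using x P_sub by (auto simp: carrier_G mult_G)
    finally show "sat M (\<lambda>_. x) ?\<theta> \<longleftrightarrow> x \<in> {x \<in> carrier G. \<exists>y\<in>P. x \<otimes>\<^bsub>G\<^esub> y \<notin> D}" .
  qed
qed

section \<open>Type-definable subgroups of bounded index\<close>

text \<open>
  A family closed under intersection whose members are definable and whose intersection is the
  type-definable set \<open>realizations M g \<Phi>\<close>.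
\<close>

definition finite_part_sets :: "('f, 'r, 's, 's \<times> 'a) fm set \<Rightarrow> 'a set set" where
  "finite_part_sets \<Phi> = realizations M g ` {\<Psi>. \<Psi> \<subseteq> \<Phi> \<and> finite \<Psi>}"

lemma finite_part_sets_carrier: "carrier G \<in> finite_part_sets \<Phi>"
  unfolding finite_part_sets_def by (rule image_eqI[of _ _ "{}"]) (auto simp: realizations_def carrier_G)

lemma finite_part_sets_Int: "D \<in> finite_part_sets \<Phi> \<Longrightarrow> E \<in> finite_part_sets \<Phi> \<Longrightarrow> D \<inter> E \<in> finite_part_sets \<Phi>"
proof -
  assume "D \<in> finite_part_sets \<Phi>" "E \<in> finite_part_sets \<Phi>"
  then obtain \<Psi> \<Psi>' where "D = realizations M g \<Psi>" "\<Psi> \<subseteq> \<Phi>" "finite \<Psi>"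
    "E = realizations M g \<Psi>'" "\<Psi>' \<subseteq> \<Phi>" "finite \<Psi>'" by (auto simp: finite_part_sets_def)
  then show ?thesis
    unfolding finite_part_sets_def by (intro image_eqI[of _ _ "\<Psi> \<union> \<Psi>'"]) (auto simp: realizations_def)
qed

lemma finite_part_sets_finite_Inter:
  "finite J \<Longrightarrow> J \<subseteq> finite_part_sets \<Phi> \<Longrightarrow> carrier G \<inter> \<Inter>J \<in> finite_part_sets \<Phi>"
proof (induction J rule: finite_induct)
  case (insert D J)
  have "carrier G \<inter> \<Inter>(insert D J) = D \<inter> (carrier G \<inter> \<Inter>J)" by auto
  then show ?case using insert finite_part_sets_Int[of D \<Phi>] by simp
qed (simp add: finite_part_sets_carrier)

lemma finite_part_sets_definable:
  assumes "\<Phi> \<subseteq> forms_x L A g"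
  shows "finite_part_sets \<Phi> \<subseteq> definable L M A g"
proof
  fix D assume "D \<in> finite_part_sets \<Phi>"
  then obtain \<Psi> where Y: "\<Psi> \<subseteq> \<Phi>" "finite \<Psi>" "D = realizations M g \<Psi>"
    by (auto simp: finite_part_sets_def)
  interpret algebra "univ M g" "definable L M A g" by (rule algebra_definable)
  have "finite \<Psi> \<Longrightarrow> \<Psi> \<subseteq> forms_x L A g \<Longrightarrow> realizations M g \<Psi> \<in> definable L M A g" for \<Psi>
  proof (induction \<Psi> rule: finite_induct)
    case empty
    have "realizations M g {} = univ M g" by (auto simp: realizations_def)
    then show ?case by simp
  next
    case (insert \<phi> \<Psi>)
    have "realizations M g (insert \<phi> \<Psi>) = realizations M g {\<phi>} \<inter> realizations M g \<Psi>"
      by (auto simp: realizations_def)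
    moreover have "realizations M g {\<phi>} \<in> definable L M A g"
      using insert.prems by (auto simp: definable_def)
    ultimately show ?case using insert by auto
  qed
  then show "D \<in> definable L M A g" using Y assms by auto
qed

lemma realizations_subset_finite_part: "D \<in> finite_part_sets \<Phi> \<Longrightarrow> realizations M g \<Phi> \<subseteq> D"
  by (auto simp: finite_part_sets_def realizations_def)

lemma realizations_from_finite_parts:
  assumes "a \<in> univ M g" "\<And>D. D \<in> finite_part_sets \<Phi> \<Longrightarrow> a \<in> D"
  shows "a \<in> realizations M g \<Phi>"
proof -
  have "realizations M g {\<phi>} \<in> finite_part_sets \<Phi>" if "\<phi> \<in> \<Phi>" for \<phi>
    using that by (auto simp: finite_part_sets_def)
  then have "a \<in> realizations M g {\<phi>}" if "\<phi> \<in> \<Phi>" for \<phi> using assms(2) that by simp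
  then show ?thesis using assms(1) by (auto simp: realizations_def)
qed

text \<open>
  A type in two variables would say that \<open>x\<close> and \<open>y\<close> lie in every \<open>E\<close> while \<open>x y\<close> is outside \<open>D\<close>; it
  cannot be realized, because the realizations of \<open>\<Phi>\<close> form a subgroup contained in \<open>D\<close>. Saturation is
  available for one variable, so \<open>x = a\<close> is realized first, with \<open>y\<close> quantified away separately for
  each \<open>E\<close>, and then \<open>y\<close> is found over the additional parameter \<open>a\<close>.
\<close>

lemma finite_part_absorbs_subgroup:
  assumes sat: "saturated L \<kappa> M" and A: "A \<subseteq> elts M" "|A| <o \<kappa>" "\<And>c. |insert c A| <o \<kappa>"
    and \<Phi>: "\<Phi> \<subseteq> forms_x L A g" and H: "subgroup (realizations M g \<Phi>) G"
    and D: "D \<in> finite_part_sets \<Phi>"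
  shows "\<exists>E\<in>finite_part_sets \<Phi>. \<forall>x\<in>E. \<forall>h\<in>realizations M g \<Phi>. x \<otimes>\<^bsub>G\<^esub> h \<in> D"
proof (rule ccontr)
  assume not: "\<not> ?thesis"
  interpret H: subgroup "realizations M g \<Phi>" G by fact
  have def: "E \<in> definable L M A g" if "E \<in> finite_part_sets \<Phi>" for E
    using finite_part_sets_definable[OF \<Phi>] that by auto
  interpret A: algebra "univ M g" "definable L M A g" by (rule algebra_definable)
  let ?T = "\<lambda>E. E \<inter> {x \<in> carrier G. \<exists>y\<in>E. x \<otimes>\<^bsub>G\<^esub> y \<notin> D}"
  have "\<exists>a\<in>univ M g. \<forall>E\<in>finite_part_sets \<Phi>. a \<in> ?T E"
  proof (rule saturated_definable_family[OF sat A(1,2)])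
    show "?T E \<in> definable L M A g" if "E \<in> finite_part_sets \<Phi>" for E
      using that D by (intro A.Int projection_definable def)
    fix J assume J: "finite J" "J \<subseteq> finite_part_sets \<Phi>"
    let ?E = "carrier G \<inter> \<Inter>J"
    have E: "?E \<in> finite_part_sets \<Phi>" using J by (rule finite_part_sets_finite_Inter)
    with not obtain x h where x: "x \<in> ?E" "h \<in> realizations M g \<Phi>" "x \<otimes>\<^bsub>G\<^esub> h \<notin> D" by blast
    have "h \<in> ?E" using x(2) realizations_subset_finite_part[OF E] by auto
    then show "\<exists>a\<in>univ M g. \<forall>E\<in>J. a \<in> ?T E"
      using x by (intro bexI[of _ x]) (auto simp: carrier_G)
  qed
  then obtain a where a: "a \<in> univ M g" "\<And>E. E \<in> finite_part_sets \<Phi> \<Longrightarrow> a \<in> ?T E" by auto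
  have aH: "a \<in> realizations M g \<Phi>" using a by (intro realizations_from_finite_parts) auto
  let ?B = "insert (g, a) A"
  interpret B: algebra "univ M g" "definable L M ?B g" by (rule algebra_definable)
  have defB: "E \<in> definable L M ?B g" if "E \<in> finite_part_sets \<Phi>" for E
    using def[OF that] definable_mono[of A ?B] by auto
  have "\<exists>b\<in>univ M g. \<forall>E\<in>finite_part_sets \<Phi>. b \<in> E - G.left_pre a D"
  proof (rule saturated_definable_family[OF sat _ A(3)])
    show "?B \<subseteq> elts M" using A(1) a(1) by (auto simp: elts_def)
    show "E - G.left_pre a D \<in> definable L M ?B g" if "E \<in> finite_part_sets \<Phi>" for E
      using defB[OF that] left_pre_definable[OF def[OF D], of a] a(1) by (auto simp: carrier_G)
    fix J assume J: "finite J" "J \<subseteq> finite_part_sets \<Phi>"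
    let ?E = "carrier G \<inter> \<Inter>J"
    have "?E \<in> finite_part_sets \<Phi>" using J by (rule finite_part_sets_finite_Inter)
    from a(2)[OF this] obtain y where "y \<in> ?E" "a \<otimes>\<^bsub>G\<^esub> y \<notin> D" by auto
    then show "\<exists>b\<in>univ M g. \<forall>E\<in>J. b \<in> E - G.left_pre a D"
      by (intro bexI[of _ y]) (auto simp: carrier_G G.left_pre_def)
  qed
  then obtain b where b: "b \<in> univ M g" "\<And>E. E \<in> finite_part_sets \<Phi> \<Longrightarrow> b \<in> E - G.left_pre a D" by auto
  have "b \<in> realizations M g \<Phi>" using b by (intro realizations_from_finite_parts) auto
  then have "a \<otimes>\<^bsub>G\<^esub> b \<in> D" using aH realizations_subset_finite_part[OF D] by auto
  then show False using b(2)[OF D] b(1) by (auto simp: G.left_pre_def carrier_G)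
qed

text \<open>
  If every left coset \<open>c H\<close> had a null neighbourhood \<open>c D\<close>, the complements
  of one such neighbourhood per coset would be sets of content one, definable over a small set because
  the index is bounded.
  Saturation would give an element in all of them, yet this element lies in some coset.
\<close>

lemma coset_of_positive_content:
  assumes sat: "saturated L \<kappa> M" and A: "A \<subseteq> elts M"
    and small: "\<And>r. |A \<union> r ` (rcosets\<^bsub>G\<^esub> realizations M g \<Phi>)| <o \<kappa>"
    and \<Phi>: "\<Phi> \<subseteq> forms_x L A g" and H: "subgroup (realizations M g \<Phi>) G"
    and "content (univ M g) (definable L M (elts M) g) \<mu>"
  shows "\<exists>c\<in>carrier G. \<forall>D\<in>finite_part_sets \<Phi>. 0 < \<mu> (G.left_pre (inv\<^bsub>G\<^esub> c) D)"
proof (rule ccontr)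
  assume not: "\<not> ?thesis"
  interpret content "univ M g" "definable L M (elts M) g" \<mu> by fact
  interpret H: subgroup "realizations M g \<Phi>" G by fact
  let ?R = "rcosets\<^bsub>G\<^esub> realizations M g \<Phi>"
  have def: "D \<in> definable L M A g" if "D \<in> finite_part_sets \<Phi>" for D
    using finite_part_sets_definable[OF \<Phi>] that by auto
  have "\<exists>r. r \<in> Y \<and> r \<in> carrier G" if Y: "Y \<in> ?R" for Y
  proof -
    obtain a where "a \<in> carrier G" "Y = realizations M g \<Phi> #>\<^bsub>G\<^esub> a"
      using Y by (auto simp: RCOSETS_def)
    then show ?thesis using G.rcos_self[OF _ H] by auto
  qed
  then obtain r where r: "\<forall>Y\<in>?R. r Y \<in> Y \<and> r Y \<in> carrier G" by (metis (no_types, lifting))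
  have "\<forall>Y\<in>?R. \<exists>D. D \<in> finite_part_sets \<Phi> \<and> \<not> 0 < \<mu> (G.left_pre (r Y) D)"
  proof
    fix Y assume "Y \<in> ?R"
    then have rY: "r Y \<in> carrier G" using r by simp
    then have "inv\<^bsub>G\<^esub> r Y \<in> carrier G" by simp
    with not have "\<exists>D\<in>finite_part_sets \<Phi>. \<not> 0 < \<mu> (G.left_pre (inv\<^bsub>G\<^esub> (inv\<^bsub>G\<^esub> r Y)) D)" by blast
    then show "\<exists>D. D \<in> finite_part_sets \<Phi> \<and> \<not> 0 < \<mu> (G.left_pre (r Y) D)" using rY by auto
  qed
  then obtain D where D: "\<forall>Y\<in>?R. D Y \<in> finite_part_sets \<Phi> \<and> \<not> 0 < \<mu> (G.left_pre (r Y) (D Y))"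
    by (auto dest: bchoice)
  let ?B = "A \<union> (\<lambda>Y. (g, r Y)) ` ?R"
  let ?T = "\<lambda>Y. univ M g - G.left_pre (r Y) (D Y)"
  have B: "?B \<subseteq> elts M" using A r by (auto simp: elts_def carrier_G)
  have defL: "G.left_pre (r Y) (D Y) \<in> definable L M ?B g" if Y: "Y \<in> ?R" for Y
  proof -
    have "G.left_pre (r Y) (D Y) \<in> definable L M (insert (g, r Y) A) g"
      using Y r D by (intro left_pre_definable def) auto
    then show ?thesis using Y definable_mono[of "insert (g, r Y) A" ?B] by auto
  qed
  interpret B: algebra "univ M g" "definable L M ?B g" by (rule algebra_definable)
  have "\<exists>b\<in>univ M g. \<forall>Y\<in>?R. b \<in> ?T Y"
  proof (rule saturated_definable_family[OF sat B small])
    show "?T Y \<in> definable L M ?B g" if "Y \<in> ?R" for Y using defL[OF that] by auto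
    fix J assume J: "finite J" "J \<subseteq> ?R"
    have T: "?T Y \<in> definable L M (elts M) g" "\<mu> (?T Y) = 1" if "Y \<in> J" for Y
    proof -
      have L: "G.left_pre (r Y) (D Y) \<in> definable L M (elts M) g"
        using defL[of Y] that J(2) definable_mono[OF B, of L M g] by auto
      then show "?T Y \<in> definable L M (elts M) g" by auto
      have "\<not> 0 < \<mu> (G.left_pre (r Y) (D Y))" using that J(2) D by auto
      then show "\<mu> (?T Y) = 1" using compl[OF L] nonneg[OF L] by simp
    qed
    have "\<mu> (univ M g \<inter> \<Inter>(?T ` J)) = 1"
    proof (rule finite_Inter_eq_one[THEN conjunct1])
      show "finite (?T ` J)" using J(1) by (rule finite_imageI)
      show "?T ` J \<subseteq> definable L M (elts M) g" using T(1) by (rule image_subsetI)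
      show "\<mu> X = 1" if "X \<in> ?T ` J" for X using that T(2) by (elim imageE) simp
    qed
    then have "univ M g \<inter> \<Inter>(?T ` J) \<noteq> {}" using empty by (metis zero_neq_one)
    then show "\<exists>b\<in>univ M g. \<forall>Y\<in>J. b \<in> ?T Y" by blast
  qed
  then obtain b where b: "b \<in> carrier G" "\<And>Y. Y \<in> ?R \<Longrightarrow> b \<in> ?T Y" by (auto simp: carrier_G)
  \<comment> \<open>Left cosets are handled as inverses of right cosets: \<open>r Y\<close> represents \<open>(r Y)^(-1) H\<close>.\<close>
  let ?Y = "realizations M g \<Phi> #>\<^bsub>G\<^esub> inv\<^bsub>G\<^esub> b"
  have Y: "?Y \<in> ?R" using b(1) H.subset by (intro G.rcosetsI) auto
  then have "r ?Y \<in> ?Y" using r by auto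
  then obtain h where h: "h \<in> realizations M g \<Phi>" "r ?Y = h \<otimes>\<^bsub>G\<^esub> inv\<^bsub>G\<^esub> b"
    unfolding r_coset_def by auto
  have "r ?Y \<otimes>\<^bsub>G\<^esub> b = h"
    unfolding h(2) using h(1) b(1) by (simp add: G.m_assoc)
  then have "r ?Y \<otimes>\<^bsub>G\<^esub> b \<in> D ?Y" using h(1) D Y realizations_subset_finite_part by blast
  then have "b \<in> G.left_pre (r ?Y) (D ?Y)" using b(1) by (simp add: G.left_pre_def)
  then show False using b(2)[OF Y] by simp
qed

section \<open>Keisler measures and definable amenability\<close>

text \<open>
  A Keisler measure respects equivalence, so it does not matter which defining formula is chosen.
\<close>

lemma keisler_content:
  assumes K: "keisler_measure L M s \<mu>"
  obtains \<nu> where "content (univ M s) (definable L M (elts M) s) \<nu>"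
    "\<And>\<phi>. \<phi> \<in> forms_x L (elts M) s \<Longrightarrow> \<nu> (realizations M s {\<phi>}) = \<mu> \<phi>"
proof -
  let ?F = "forms_x L (elts M) s"
  note K' = K[unfolded keisler_measure_def]
  note K_nonneg = K'[THEN conjunct1]
    and K_true = K'[THEN conjunct2, THEN conjunct1]
    and K_cong = K'[THEN conjunct2, THEN conjunct2, THEN conjunct1]
    and K_add = K'[THEN conjunct2, THEN conjunct2, THEN conjunct2]
  define \<nu> where "\<nu> X = \<mu> (SOME \<phi>. \<phi> \<in> ?F \<and> realizations M s {\<phi>} = X)" for X
  have n: "\<nu> (realizations M s {\<phi>}) = \<mu> \<phi>" if "\<phi> \<in> ?F" for \<phi>
  proof -
    let ?P = "\<lambda>\<psi>. \<psi> \<in> ?F \<and> realizations M s {\<psi>} = realizations M s {\<phi>}"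
    have "?P (SOME \<psi>. ?P \<psi>)" by (rule someI[of ?P \<phi>]) (simp add: that)
    then show ?thesis using K_cong that unfolding \<nu>_def by blast
  qed
  have "finitely_additive_prob (univ M s) (definable L M (elts M) s) \<nu>"
    unfolding finitely_additive_prob_def
  proof (intro conjI ballI impI)
    show "0 \<le> \<nu> X" if "X \<in> definable L M (elts M) s" for X
      using that K_nonneg n unfolding definable_def by (elim imageE) simp
    show "\<nu> (univ M s) = 1"
      using n[OF true_forms_x] K_true by (simp add: realizations_true)
    fix X Y assume "X \<in> definable L M (elts M) s" "Y \<in> definable L M (elts M) s"
    then obtain \<phi> \<psi> where F: "\<phi> \<in> ?F" "X = realizations M s {\<phi>}" "\<psi> \<in> ?F" "Y = realizations M s {\<psi>}"
      by (auto simp: definable_def)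
    assume "X \<inter> Y = {}"
    then have "realizations M s {\<phi>, \<psi>} = {}" by (auto simp: F realizations_def)
    then have "\<mu> (Disj \<phi> \<psi>) = \<mu> \<phi> + \<mu> \<psi>"
      using K_add F(1,3) by blast
    moreover have "Disj \<phi> \<psi> \<in> ?F" using F(1,3) by (intro Neg_forms_x Conj_forms_x)
    ultimately show "\<nu> (X \<union> Y) = \<nu> X + \<nu> Y"
      using n F realizations_Disj[OF F(1,3)] by metis
  qed
  then have "content (univ M s) (definable L M (elts M) s) \<nu>"
    using algebra_definable by (simp add: content_def content_axioms_def)
  then show thesis using n by (rule that)
qed

lemma content_keisler:
  assumes "content (univ M s) (definable L M (elts M) s) \<nu>"
  shows "keisler_measure L M s (\<lambda>\<phi>. \<nu> (realizations M s {\<phi>}))"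
proof -
  interpret content "univ M s" "definable L M (elts M) s" \<nu> by fact
  have d: "realizations M s {\<phi>} \<in> definable L M (elts M) s" if "\<phi> \<in> forms_x L (elts M) s" for \<phi>
    using that by (auto simp: definable_def)
  have "\<nu> (realizations M s {Disj \<phi> \<psi>}) = \<nu> (realizations M s {\<phi>}) + \<nu> (realizations M s {\<psi>})"
    if "\<phi> \<in> forms_x L (elts M) s" "\<psi> \<in> forms_x L (elts M) s" "realizations M s {\<phi>, \<psi>} = {}" for \<phi> \<psi>
  proof -
    have "realizations M s {\<phi>} \<inter> realizations M s {\<psi>} = {}"
      using that(3) by (auto simp: realizations_def)
    then show ?thesis unfolding realizations_Disj[OF that(1,2)] by (intro add d that(1,2))
  qed
  then show ?thesis
    unfolding keisler_measure_def using d nonneg total by (simp add: realizations_true)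
qed

end

theorem proposition3p20:
  fixes L :: "('f, 'r, 's) language"
    and T :: "('f, 'r, 's, 's \<times> 'a) fm set"
    and \<kappa> :: "'k rel"
    and \<G> :: "('f, 'r, 's, 'a) model"
    and g :: 's and m :: 'f
    and \<H> :: "('f, 'r, 's, 's \<times> 'a) fm set"
  assumes "monster_model L T \<kappa> \<G>"
    and "expands_group L \<G> g m"
    and "NIP L \<G>"
    and "definably_amenable L \<G> g m (whole_group g)"
    and "type_defines_subgroup L \<kappa> \<G> g m \<H>"
    and "bounded_index \<kappa> \<G> g m (realizations \<G> g \<H>)"
  shows "definably_amenable L \<G> g m \<H>"
proof -
  interpret definable_group L \<G> g m
    using assms(1,2) by unfold_locales (auto simp: monster_model_def)
  let ?F = "forms_x L (elts \<G>) g" and ?\<B> = "definable L \<G> (elts \<G>) g"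
  let ?H = "realizations \<G> g \<H>"
  have sat: "saturated L \<kappa> \<G>" using assms(1) by (simp add: monster_model_def)
  have \<kappa>: "Card_order \<kappa>" and lang: "|formulas L ({} :: ('s \<times> 'a) set) UNIV| <o \<kappa>"
    using assms(1) by (auto simp: monster_model_def strong_limit_def)
  \<comment> \<open>The formulas \<open>x_n = x_n\<close> are infinitely many, and there are fewer than \<open>\<kappa>\<close> of them.\<close>
  have inf: "infinite (Field \<kappa>)"
  proof
    assume "finite (Field \<kappa>)"
    then have "finite (formulas L ({} :: ('s \<times> 'a) set) UNIV)"
      using lang \<kappa> by (meson card_of_Field_ordIso card_of_ordLeq_finite ordIso_symmetric
          ordLess_imp_ordLeq ordLess_ordIso_trans)
    moreover have "range (\<lambda>n. Eq (Var (g, n)) (Var (g, n))) \<subseteq> formulas L ({} :: ('s \<times> 'a) set) UNIV"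
      by (auto simp: formulas_def intro!: exI[of _ g] has_sort.intros(1))
    moreover have "infinite (range (\<lambda>n::nat. Eq (Var (g, n)) (Var (g, n)) :: ('f, 'r, 's, 's \<times> 'a) fm))"
      by (rule range_inj_infinite) (simp add: inj_def)
    ultimately show False using finite_subset by blast
  qed
  obtain A where A: "A \<subseteq> elts \<G>" "|A| <o \<kappa>" "\<H> \<subseteq> forms_x L A g" and H: "subgroup ?H G"
    using assms(5) by (auto simp: type_defines_subgroup_def)
  have union: "|A \<union> X| <o \<kappa>" if "|X| <o \<kappa>" for X
    using card_of_Un_ordLess_infinite_Field[OF inf \<kappa> A(2) that] .
  have small1: "|insert c A| <o \<kappa>" for c
  proof -
    have "|{c}| <o \<kappa>"
      using \<kappa> inf by (intro finite_ordLess_infinite) (auto simp: Field_card_of card_order_on_def card_of_well_order_on)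
    then show ?thesis using union[of "{c}"] by simp
  qed
  have small2: "|A \<union> r ` (rcosets\<^bsub>G\<^esub> ?H)| <o \<kappa>" for r
    using assms(6) card_of_image ordLeq_ordLess_trans
    unfolding bounded_index_def by (intro union) blast
  have HF: "\<H> \<subseteq> ?F" using A(1,3) by (auto simp: forms_x_def formulas_def)
  obtain \<mu> where \<mu>: "keisler_measure L \<G> g \<mu>"
    "\<forall>\<phi>\<in>?F. \<forall>a\<in>realizations \<G> g (whole_group g). \<mu> \<phi> = \<mu> (translate g m a \<phi>)"
    using assms(4) by (auto simp: definably_amenable_def)
  obtain \<mu>' where \<mu>': "content (univ \<G> g) ?\<B> \<mu>'"
    "\<And>\<phi>. \<phi> \<in> ?F \<Longrightarrow> \<mu>' (realizations \<G> g {\<phi>}) = \<mu> \<phi>" using keisler_content[OF \<mu>(1)] by metis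
  have inv: "G.invariant_under (carrier G) ?\<B> \<mu>'"
    unfolding G.invariant_under_def
  proof (intro ballI)
    fix a X assume a: "a \<in> carrier G" and "X \<in> ?\<B>"
    then obtain \<phi> where p: "\<phi> \<in> ?F" "X = realizations \<G> g {\<phi>}" by (auto simp: definable_def)
    have "\<mu> \<phi> = \<mu> (translate g m a \<phi>)"
      using \<mu>(2) p(1) a by (simp add: whole_group_def realizations_true carrier_G)
    then show "\<mu>' (G.right_pre a X) = \<mu>' X"
      using \<mu>'(2)[OF p(1)] \<mu>'(2)[OF translate_forms_x[OF p(1) subset_refl a]]
        realizations_translate[OF p(1) a] p(2) by simp
  qed
  obtain c where c: "c \<in> carrier G" "\<forall>D\<in>finite_part_sets \<H>. 0 < \<mu>' (G.left_pre (inv\<^bsub>G\<^esub> c) D)"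
    using coset_of_positive_content[OF sat A(1) small2 A(3) H \<mu>'(1)] by auto
  obtain \<nu> where \<nu>: "finitely_additive_prob (carrier G) ?\<B> \<nu>" "G.invariant_under ?H ?\<B> \<nu>"
    "\<And>D. D \<in> finite_part_sets \<H> \<Longrightarrow> \<nu> D = 1"
  proof (rule G.invariant_content_on_subgroup)
    show "content (carrier G) ?\<B> \<mu>'" using \<mu>'(1) by (simp add: carrier_G)
    show "subgroup ?H G" by fact
    show "G.left_pre c X \<in> ?\<B>" if "c \<in> carrier G" "X \<in> ?\<B>" for c X
    proof -
      have "insert (g, c) (elts \<G>) = elts \<G>" using that(1) by (auto simp: elts_def carrier_G)
      then show ?thesis using left_pre_definable[OF that(2,1)] by simp
    qed
    show "G.right_pre a X \<in> ?\<B>" if "a \<in> carrier G" "X \<in> ?\<B>" for a X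
      using that by (intro right_pre_definable)
    show "finite_part_sets \<H> \<subseteq> ?\<B>" using HF by (rule finite_part_sets_definable)
    show "\<exists>E\<in>finite_part_sets \<H>. \<forall>x\<in>E. \<forall>h\<in>?H. x \<otimes>\<^bsub>G\<^esub> h \<in> D" if "D \<in> finite_part_sets \<H>" for D
      using finite_part_absorbs_subgroup[OF sat A(1,2) small1 A(3) H that] .
  qed (use c inv finite_part_sets_carrier finite_part_sets_Int in auto)
  have content: "content (univ \<G> g) ?\<B> \<nu>"
    using \<nu>(1) algebra_definable by (simp add: content_def content_axioms_def carrier_G)
  obtain N where N: "borel_extension L \<G> g (\<lambda>\<phi>. \<nu> (realizations \<G> g {\<phi>})) N"
    "measure N (types_containing L \<G> g \<H>) = 1"
  proof -
    have "\<nu> (realizations \<G> g {\<phi>}) = 1" if "\<phi> \<in> \<H>" for \<phi>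
      using that \<nu>(3) by (auto simp: finite_part_sets_def)
    then show thesis using borel_extension_exists[OF content] HF that by metis
  qed
  have "\<nu> (realizations \<G> g {translate g m a \<phi>}) = \<nu> (realizations \<G> g {\<phi>})"
    if "\<phi> \<in> ?F" "a \<in> ?H" for \<phi> a
  proof -
    have "a \<in> carrier G" using that(2) by (auto simp: realizations_def carrier_G)
    then show ?thesis
      using \<nu>(2) that by (auto simp: G.invariant_under_def realizations_translate definable_def)
  qed
  then show ?thesis
    unfolding definably_amenable_def
    using content_keisler[OF content] N by (intro exI[of _ "\<lambda>\<phi>. \<nu> (realizations \<G> g {\<phi>})"]) auto
qed

end
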